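(* Let $n\ge1$, let $\pi$ be an abelian group and $\Lambda$ a commutative ring, and let $F\to E\to B$ be a Serre fibration whose fiber $F$ is a $K(\pi,n)$-space. Let $z^{n+1}\in Z^{n+1}(B,\pi)$ be a cocycle in the obstruction class of the fibration, and let $Y^{**}_{z^{n+1}}(B,\pi,n,\Lambda)$ be the corresponding cohomology model. Then the canonical cochain map (defined up to chain homotopy and inducing an isomorphism of cohomology; its construction is recalled in the context) $$C^*_\Box(E,\Lambda)\to Y^{**}_{z^{n+1}}(B,\pi,n,\Lambda)$$ is multiplicative (with respect to the Serre cup products on both sides).
   Context: **Cubical sets.** For a cubical set $Q$ with faces $d_i^{\epsilon}$ ($\epsilon=0,1$) and degeneracies $s_i$, $C_*^{\Box}(Q)$ is the free graded abelian group on the cubes, with $d\sigma=\sum_i(-1)^i d^0_i\sigma-\sum_i(-1)^i d^1_i\sigma$, modulo the degenerate cubes; $C^*_\Box(Q,\Lambda)$ denotes the normalized cochains (zero on degenerate cubes). $C^*_\Box(E,\Lambda)$ is that of the singular cubical set $Q(E)$. $S(B)$ is the singular simplicial set of $B$. **Serre cup product.** For normalized cochains $x$, $y$ of degrees $s$, $t$ and an $(s+t)$-cube $\tau$, $(x\smile y)(\tau)=\sum_{(H,K)}(-1)^{a(H,K)}x(d^0_K\tau)\,y(d^1_H\tau)$, the sum over decompositions of $\{1,\dots,s+t\}$ into disjoint subsets $H,K$ with $|H|=s$, $|K|=t$; here $d_K^\epsilon=d^\epsilon_{i_1}\cdots d^\epsilon_{i_k}$ for $K=\{i_1<\dots<i_k\}$,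 and $(-1)^{a(H,K)}$ is Serre's sign ($a(H,K)$ is the number of pairs $(h,k)\in H\times K$ with $k<h$). The same formula is used for any cubical complex, in particular for $S(B)\times_zL(\pi,n)$ below. **$L(\pi,n)$.** The cubical set whose $p$-cubes are the cellular $n$-cocycles $Z^n(I^p,\pi)$ of the standard cube; faces are restrictions to the faces of $I^p$, degeneracies are pull-backs along the projections $I^{p+1}\to I^p$. For a $p$-cube $\sigma$ and a $q$-cube $\tau$ put $\sigma\circ\tau=pr_1^*\sigma+pr_2^*\tau\in Z^n(I^{p+q},\pi)$. **$\kappa_z$.** For $z\in Z^{n+1}(B,\pi)$ and a singular $(m+1)$-simplex $\sigma$ of $B$, the $m$-cube $\kappa_z(\sigma)\in Z^n(I^m,\pi)$ is defined as follows. Use coordinates $(x_2,\dots,x_{m+1})$ on $I^m$ and put $x_1=0$. Let $w$ be an $n$-face of $I^m$ with free coordinates $x_{i_1},\dots,x_{i_n}$, $i_1<\dots<i_n$, the others fixed at $0$ or $1$. If some fixed $x_l$ with $i_1<l<i_n$ is $0$, then $\kappa_z(\sigma)(w)=0$. Otherwise let $r$ be the largest index $<i_1$ with $x_r=0$ and $q$ the smallest index $>i_n$ with $x_q=0$ ($q=m+2$ if there is none); then $\kappa_z(\sigma)(w)$ is the value of $z$ on the face of $\sigma$ with vertices $r-1<i_1-1<\dots<i_n-1<q-1$. **The model.** $S(B)\times_zL(\pi,n)$ is the cubical complex whose $(p+q)$-cubes are the pairs $(\sigma^p,\tau^q)$, $\sigma^p\in S(B)$, $\tau^q\in L(\pi,n)$,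 with $d^\epsilon_{p+i}(\sigma,\tau)=(\sigma,d_i^\epsilon\tau)$ for $1\le i\le q$; $d^1_i(\sigma,\tau)=(\sigma_{i-1},\tau)$ for $1\le i\le p$ ($\sigma_j$ the face omitting vertex $j$); $d_p^0(\sigma,\tau)=(\sigma_p,\tau)$; $d_i^0(\sigma,\tau)=(\sigma_{[0,\dots,i-1]},\kappa_z(\sigma_{[i-1,\dots,p]})\circ\tau)$ for $1\le i\le p-1$; and degeneracies $s_{p+i}(\sigma,\tau)=(\sigma,s_i\tau)$, $1\le i\le q+1$. The cohomology model $Y^{**}_z(B,\pi,n,\Lambda)$, which as a graded module is $C^*(B,C^*_\Box(L(\pi,n),\Lambda))$, is identified with the normalized cochain complex $C_\Box^*(S(B)\times_zL(\pi,n),\Lambda)$ and carries its Serre cup product. **The cochain map.** Let $\|S(B)\|$ be the realization of $S(B)$ using only face identifications, $E'\to\|S(B)\|$ the pull-back of $E\to B$ along $\|S(B)\|\to B$, and $\alpha:|S(B)\times_zL(\pi,n)|\to\|S(B)\|$ the map given on $(\sigma^p,\tau^q)$ by $I^{p+q}\to I^p\to\Delta_p$ (projection, then $y_0=1-x_1$, $y_j=x_1\cdots x_j(1-x_{j+1})$ for $0<j<p$, $y_p=x_1\cdots x_p$). Starting from a cross section $s$ of $E'$ over the $n$-skeleton of $\|S(B)\|$ with obstruction cocycle $z$, one constructs cell by cell a map $f:|S(B)\times_zL(\pi,n)|\to E'$ over $\|S(B)\|$: $f=s\alpha$ on cells of dimension $\le n$ other than $(\sigma^0,\tau^n)$; on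 $(\sigma^0,\tau^n)$, with $\tau^n$ given by $g\in\pi$, $f$ represents $g\in\pi_n(F,s(\sigma^0))$; then $f$ is extended over the higher cells. The cochain map is induced by the resulting map of cubical sets $S(B)\times_zL(\pi,n)\to Q(E)$ sending $(\sigma^p,\tau^q)$ to $I^{p+q}\to|S(B)\times_zL(\pi,n)|\xrightarrow{f}E'\to E$. *)

theory Defs
  imports "HOL-Homology.Homology"
begin

section \<open>Cubes\<close>

text \<open>As for \<^const>\<open>standard_simplex\<close>, a point of \<open>I\<^sup>m\<close> is a function on all of \<open>nat\<close>. Its coordinates are
  numbered \<open>1, \<dots>, m\<close>, and it vanishes at every other index, in particular at \<open>0\<close>.\<close>

definition standard_cube :: "nat \<Rightarrow> (nat \<Rightarrow> real) set" where
  "standard_cube m = {x. (\<forall>i. 0 \<le> x i \<and> x i \<le> 1) \<and> (\<forall>i. i \<notin> {1..m} \<longrightarrow> x i = 0)}"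

definition cube_topology :: "nat \<Rightarrow> (nat \<Rightarrow> real) topology" where
  "cube_topology m = subtopology (powertop_real UNIV) (standard_cube m)"

definition cube_boundary :: "nat \<Rightarrow> (nat \<Rightarrow> real) set" where
  "cube_boundary m = {x \<in> standard_cube m. \<exists>i\<in>{1..m}. x i = 0 \<or> x i = 1}"

text \<open>The inclusion of the face \<open>x\<^sub>i = v\<close> and the projection omitting \<open>x\<^sub>i\<close> (for \<open>1 \<le> i\<close>). They are
  polymorphic because they act on points of cubes and on cells of cubes alike.\<close>

definition cube_insert :: "nat \<Rightarrow> 'v \<Rightarrow> (nat \<Rightarrow> 'v) \<Rightarrow> nat \<Rightarrow> 'v" where
  "cube_insert i v x = (\<lambda>j. if j < i then x j else if j = i then v else x (j - 1))"

definition cube_delete :: "nat \<Rightarrow> (nat \<Rightarrow> 'v) \<Rightarrow> nat \<Rightarrow> 'v" where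
  "cube_delete i x = (\<lambda>j. if j < i then x j else x (Suc j))"


section \<open>Cubical complexes and their normalized cochains\<close>

text \<open>\<open>face K m \<epsilon> i\<close> is \<open>d\<^sub>i\<^sup>\<epsilon>\<close> on \<open>m\<close>-cubes, where \<open>\<epsilon> :: bool\<close> stands for \<open>of_bool \<epsilon>\<close>, and \<open>degen K m i\<close>
  is \<open>s\<^sub>i\<close> on \<open>m\<close>-cubes. In the twisted product below not every \<open>s\<^sub>i\<close> is available on every cube, so
  \<open>degen_index K m c\<close> is the set of those \<open>i\<close> for which \<open>s\<^sub>i c\<close> is defined.\<close>

record 'c cubical_complex =
  cubes :: "nat \<Rightarrow> 'c set"
  face :: "nat \<Rightarrow> bool \<Rightarrow> nat \<Rightarrow> 'c \<Rightarrow> 'c"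
  degen_index :: "nat \<Rightarrow> 'c \<Rightarrow> nat set"
  degen :: "nat \<Rightarrow> nat \<Rightarrow> 'c \<Rightarrow> 'c"

definition degenerate_cubes :: "'c cubical_complex \<Rightarrow> nat \<Rightarrow> 'c set" where
  "degenerate_cubes K m =
    {degen K k i c | k i c. m = Suc k \<and> c \<in> cubes K k \<and> i \<in> degen_index K k c}"

text \<open>A cochain is a function on cubes, extended by zero to the whole type.\<close>

definition normalized_cochains :: "'c cubical_complex \<Rightarrow> nat \<Rightarrow> ('c \<Rightarrow> 'l::comm_ring_1) set" where
  "normalized_cochains K m =
    {x. (\<forall>c. c \<notin> cubes K m \<longrightarrow> x c = 0) \<and> (\<forall>c\<in>degenerate_cubes K m. x c = 0)}"

definition cubical_coboundary ::
    "'c cubical_complex \<Rightarrow> nat \<Rightarrow> ('c \<Rightarrow> 'l::comm_ring_1) \<Rightarrow> 'c \<Rightarrow> 'l" where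
  "cubical_coboundary K m x = (\<lambda>c. if c \<in> cubes K (Suc m)
      then (\<Sum>i=1..Suc m. (- 1) ^ i * x (face K (Suc m) False i c))
         - (\<Sum>i=1..Suc m. (- 1) ^ i * x (face K (Suc m) True i c))
      else 0)"

text \<open>\<open>d\<^sup>\<epsilon>\<^bsub>i\<^sub>1\<^esub> \<cdots> d\<^sup>\<epsilon>\<^bsub>i\<^sub>k\<^esub>\<close> applied to an \<open>m\<close>-cube; the last index acts first.\<close>

primrec faces_along :: "'c cubical_complex \<Rightarrow> nat \<Rightarrow> bool \<Rightarrow> nat list \<Rightarrow> 'c \<Rightarrow> 'c" where
  "faces_along K m \<epsilon> [] c = c"
| "faces_along K m \<epsilon> (i # js) c = face K (m - length js) \<epsilon> i (faces_along K m \<epsilon> js c)"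

definition multi_face :: "'c cubical_complex \<Rightarrow> nat \<Rightarrow> bool \<Rightarrow> nat set \<Rightarrow> 'c \<Rightarrow> 'c" where
  "multi_face K m \<epsilon> S = faces_along K m \<epsilon> (sorted_list_of_set S)"

definition serre_cup ::
    "'c cubical_complex \<Rightarrow> nat \<Rightarrow> nat \<Rightarrow> ('c \<Rightarrow> 'l::comm_ring_1) \<Rightarrow> ('c \<Rightarrow> 'l) \<Rightarrow> 'c \<Rightarrow> 'l" where
  "serre_cup K s t x y = (\<lambda>c. if c \<in> cubes K (s + t)
      then (\<Sum>(H, L) \<in> {(H, L). H \<union> L = {1..s + t} \<and> H \<inter> L = {} \<and> card H = s \<and> card L = t}.
              (- 1) ^ card {(h, l). h \<in> H \<and> l \<in> L \<and> l < h}
              * x (multi_face K (s + t) False L c) * y (multi_face K (s + t) True H c))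
      else 0)"

definition cochain_map ::
    "'c cubical_complex \<Rightarrow> 'd cubical_complex \<Rightarrow> (nat \<Rightarrow> ('c \<Rightarrow> 'l::comm_ring_1) \<Rightarrow> 'd \<Rightarrow> 'l) \<Rightarrow> bool" where
  "cochain_map K L \<phi> \<longleftrightarrow> (\<forall>m. \<forall>x \<in> normalized_cochains K m.
      \<phi> m x \<in> normalized_cochains L m
    \<and> (\<forall>y \<in> normalized_cochains K m. \<phi> m (\<lambda>c. x c + y c) = (\<lambda>c. \<phi> m x c + \<phi> m y c))
    \<and> (\<forall>a. \<phi> m (\<lambda>c. a * x c) = (\<lambda>c. a * \<phi> m x c))
    \<and> \<phi> (Suc m) (cubical_coboundary K m x) = cubical_coboundary L m (\<phi> m x))"

definition multiplicative ::
    "'c cubical_complex \<Rightarrow> 'd cubical_complex \<Rightarrow> (nat \<Rightarrow> ('c \<Rightarrow> 'l::comm_ring_1) \<Rightarrow> 'd \<Rightarrow> 'l) \<Rightarrow> bool" where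
  "multiplicative K L \<phi> \<longleftrightarrow> (\<forall>s t. \<forall>x \<in> normalized_cochains K s. \<forall>y \<in> normalized_cochains K t.
      \<phi> (s + t) (serre_cup K s t x y) = serre_cup L s t (\<phi> s x) (\<phi> t y))"

definition induced_cochain_map ::
    "'d cubical_complex \<Rightarrow> (nat \<Rightarrow> 'd \<Rightarrow> 'c) \<Rightarrow> nat \<Rightarrow> ('c \<Rightarrow> 'l::comm_ring_1) \<Rightarrow> 'd \<Rightarrow> 'l" where
  "induced_cochain_map L F m x = (\<lambda>c. if c \<in> cubes L m then x (F m c) else 0)"

definition singular_cubical_set :: "'e topology \<Rightarrow> ((nat \<Rightarrow> real) \<Rightarrow> 'e) cubical_complex" where
  "singular_cubical_set X = \<lparr>
     cubes = (\<lambda>m. {f. continuous_map (cube_topology m) X f \<and> f \<in> extensional (standard_cube m)}),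
     face = (\<lambda>m \<epsilon> i f. restrict (f \<circ> cube_insert i (of_bool \<epsilon>)) (standard_cube (m - 1))),
     degen_index = (\<lambda>m f. {1..Suc m}),
     degen = (\<lambda>m i f. restrict (f \<circ> cube_delete i) (standard_cube (Suc m)))\<rparr>"


section \<open>The cubical set of cellular cocycles of cubes\<close>

text \<open>A cell of \<open>I\<^sup>q\<close> assigns to each coordinate an end point of \<open>I\<close> or leaves it free. Indices outside
  \<open>{1..q}\<close> carry the end point \<open>0\<close>, as for points of the cube.\<close>

datatype interval_cell = Fixed bool | Free

definition free_coords :: "(nat \<Rightarrow> interval_cell) \<Rightarrow> nat set" where
  "free_coords w = {i. w i = Free}"

definition cube_cells :: "nat \<Rightarrow> nat \<Rightarrow> (nat \<Rightarrow> interval_cell) set" where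
  "cube_cells q k = {w. (\<forall>i. i \<notin> {1..q} \<longrightarrow> w i = Fixed False) \<and> card (free_coords w) = k}"

definition top_cell :: "nat \<Rightarrow> nat \<Rightarrow> interval_cell" where
  "top_cell q = (\<lambda>i. if i \<in> {1..q} then Free else Fixed False)"

definition alt_sign :: "nat \<Rightarrow> 'a::ab_group_add \<Rightarrow> 'a" where
  "alt_sign j a = (if even j then a else - a)"

definition cellular_cocycles :: "nat \<Rightarrow> nat \<Rightarrow> ((nat \<Rightarrow> interval_cell) \<Rightarrow> 'a::ab_group_add) set" where
  "cellular_cocycles n q = {u. (\<forall>w. w \<notin> cube_cells q n \<longrightarrow> u w = 0) \<and>
     (\<forall>w \<in> cube_cells q (Suc n).
        (\<Sum>i\<in>free_coords w. alt_sign (card {k \<in> free_coords w. k \<le> i})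
            (u (w(i := Fixed False)) - u (w(i := Fixed True)))) = 0)}"

definition L_face :: "nat \<Rightarrow> nat \<Rightarrow> bool \<Rightarrow> nat
    \<Rightarrow> ((nat \<Rightarrow> interval_cell) \<Rightarrow> 'a::ab_group_add) \<Rightarrow> (nat \<Rightarrow> interval_cell) \<Rightarrow> 'a" where
  "L_face n q \<epsilon> i u = (\<lambda>w. if w \<in> cube_cells (q - 1) n then u (cube_insert i (Fixed \<epsilon>) w) else 0)"

text \<open>A cell on which the \<open>i\<close>-th coordinate is free is collapsed by the projection, so the pulled back
  cochain vanishes on it.\<close>

definition L_degen :: "nat \<Rightarrow> nat \<Rightarrow> nat
    \<Rightarrow> ((nat \<Rightarrow> interval_cell) \<Rightarrow> 'a::ab_group_add) \<Rightarrow> (nat \<Rightarrow> interval_cell) \<Rightarrow> 'a" where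
  "L_degen n q i u =
    (\<lambda>w. if w \<in> cube_cells (Suc q) n \<and> w i \<noteq> Free then u (cube_delete i w) else 0)"

definition L_complex :: "nat \<Rightarrow> ((nat \<Rightarrow> interval_cell) \<Rightarrow> 'a::ab_group_add) cubical_complex" where
  "L_complex n = \<lparr>
     cubes = cellular_cocycles n,
     face = L_face n,
     degen_index = (\<lambda>q u. {1..Suc q}),
     degen = L_degen n\<rparr>"

text \<open>\<open>u \<circ> v = pr\<^sub>1\<^sup>* u + pr\<^sub>2\<^sup>* v\<close> on \<open>I\<^sup>a \<times> I\<^sup>b\<close>.\<close>

definition cocycle_prod :: "nat \<Rightarrow> nat \<Rightarrow> nat \<Rightarrow> ((nat \<Rightarrow> interval_cell) \<Rightarrow> 'a::ab_group_add)
    \<Rightarrow> ((nat \<Rightarrow> interval_cell) \<Rightarrow> 'a) \<Rightarrow> (nat \<Rightarrow> interval_cell) \<Rightarrow> 'a" where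
  "cocycle_prod n a b u v = (\<lambda>w. if w \<in> cube_cells (a + b) n
     then (if free_coords w \<subseteq> {1..a} then u (\<lambda>i. if i \<le> a then w i else Fixed False) else 0)
        + (if free_coords w \<subseteq> {a+1..a+b} then v (\<lambda>i. if i = 0 then Fixed False else w (i + a)) else 0)
     else 0)"


section \<open>Singular cochains of the base and the cubes \<open>\<kappa>\<^sub>z(\<sigma>)\<close>\<close>

definition singular_coboundary ::
    "nat \<Rightarrow> (((nat \<Rightarrow> real) \<Rightarrow> 'b) \<Rightarrow> 'a::ab_group_add) \<Rightarrow> ((nat \<Rightarrow> real) \<Rightarrow> 'b) \<Rightarrow> 'a" where
  "singular_coboundary k z \<sigma> = (\<Sum>j\<le>Suc k. alt_sign j (z (singular_face (Suc k) j \<sigma>)))"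

definition singular_cocycles ::
    "nat \<Rightarrow> 'b topology \<Rightarrow> (((nat \<Rightarrow> real) \<Rightarrow> 'b) \<Rightarrow> 'a::ab_group_add) set" where
  "singular_cocycles k B = {z. (\<forall>\<sigma>. \<not> singular_simplex k B \<sigma> \<longrightarrow> z \<sigma> = 0) \<and>
     (\<forall>\<sigma>. singular_simplex (Suc k) B \<sigma> \<longrightarrow> singular_coboundary k z \<sigma> = 0)}"

text \<open>The face of \<open>\<sigma>\<close> spanned by the vertices in the (increasing, nonempty) list \<open>vs\<close>.\<close>

definition vertex_face :: "((nat \<Rightarrow> real) \<Rightarrow> 'b) \<Rightarrow> nat list \<Rightarrow> (nat \<Rightarrow> real) \<Rightarrow> 'b" where
  "vertex_face \<sigma> vs = simplex_map (length vs - 1) \<sigma>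
     (oriented_simplex (length vs - 1) (\<lambda>a i. if i = vs ! a then 1 else 0))"

text \<open>\<open>\<kappa>\<^sub>z\<close> on \<open>(m+1)\<close>-simplices. In the usual description the coordinates on \<open>I\<^sup>m\<close> are \<open>x\<^sub>2, \<dots>, x\<^bsub>m+1\<^esub>\<close>
  together with \<open>x\<^sub>1 = 0\<close>, and \<open>x\<^sub>l\<close> corresponds to the vertex \<open>l - 1\<close>. Here \<open>x\<^sub>l\<close> is \<open>w (l - 1)\<close>, so an
  index of \<open>w\<close> is at the same time a vertex number. The conventions \<open>w 0 = Fixed False\<close> and
  \<open>w (m + 1) = Fixed False\<close> supply \<open>x\<^sub>1 = 0\<close> and the value \<open>m + 2\<close> for \<open>q\<close> when no zero follows the
  free coordinates; \<open>r\<close> and \<open>q\<close> below are the vertices \<open>r - 1\<close> and \<open>q - 1\<close> of that description.\<close>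

definition kappa :: "nat \<Rightarrow> nat \<Rightarrow> (((nat \<Rightarrow> real) \<Rightarrow> 'b) \<Rightarrow> 'a::ab_group_add)
    \<Rightarrow> ((nat \<Rightarrow> real) \<Rightarrow> 'b) \<Rightarrow> (nat \<Rightarrow> interval_cell) \<Rightarrow> 'a" where
  "kappa n m z \<sigma> = (\<lambda>w.
     if w \<notin> cube_cells m n then 0
     else if \<exists>l. Min (free_coords w) < l \<and> l < Max (free_coords w) \<and> w l = Fixed False then 0
     else let r = Max {l. l < Min (free_coords w) \<and> w l = Fixed False};
              q = (LEAST l. Max (free_coords w) < l \<and> w l = Fixed False)
          in z (vertex_face \<sigma> (r # sorted_list_of_set (free_coords w) @ [q])))"


section \<open>The twisted product \<open>S(B) \<times>\<^sub>z L(\<pi>,n)\<close>\<close>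

text \<open>The pair \<open>(\<sigma>\<^sup>p, \<tau>\<^sup>q)\<close> is represented with its two dimensions, as \<open>((p, \<sigma>), (q, \<tau>))\<close>.\<close>

type_synonym ('b, 'a) model_cube =
  "(nat \<times> ((nat \<Rightarrow> real) \<Rightarrow> 'b)) \<times> (nat \<times> ((nat \<Rightarrow> interval_cell) \<Rightarrow> 'a))"

fun model_face :: "nat \<Rightarrow> (((nat \<Rightarrow> real) \<Rightarrow> 'b) \<Rightarrow> 'a::ab_group_add) \<Rightarrow> bool \<Rightarrow> nat
    \<Rightarrow> ('b, 'a) model_cube \<Rightarrow> ('b, 'a) model_cube" where
  "model_face n z \<epsilon> i ((p, \<sigma>), (q, \<tau>)) =
    (if p < i then ((p, \<sigma>), (q - 1, face (L_complex n) q \<epsilon> (i - p) \<tau>))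
     else if \<epsilon> then ((p - 1, singular_face p (i - 1) \<sigma>), (q, \<tau>))
     else if i = p then ((p - 1, singular_face p p \<sigma>), (q, \<tau>))
     else ((i - 1, vertex_face \<sigma> [0..<i]),
           (p - i + q,
            cocycle_prod n (p - i) q (kappa n (p - i) z (vertex_face \<sigma> [i - 1..<Suc p])) \<tau>)))"

definition twisted_product :: "'b topology \<Rightarrow> nat \<Rightarrow> (((nat \<Rightarrow> real) \<Rightarrow> 'b) \<Rightarrow> 'a::ab_group_add)
    \<Rightarrow> ('b, 'a) model_cube cubical_complex" where
  "twisted_product B n z = \<lparr>
     cubes = (\<lambda>m. {((p, \<sigma>), (q, \<tau>)) | p \<sigma> q \<tau>.
                p + q = m \<and> singular_simplex p B \<sigma> \<and> \<tau> \<in> cubes (L_complex n) q}),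
     face = (\<lambda>m. model_face n z),
     degen_index = (\<lambda>m ((p, \<sigma>), (q, \<tau>)). {p + 1..p + q + 1}),
     degen = (\<lambda>m i ((p, \<sigma>), (q, \<tau>)). ((p, \<sigma>), (Suc q, degen (L_complex n) q (i - p) \<tau>)))\<rparr>"


section \<open>Realizations\<close>

definition quotient_class :: "('x \<Rightarrow> 'x \<Rightarrow> bool) \<Rightarrow> 'x \<Rightarrow> 'x set" where
  "quotient_class r a = {b. equivclp r a b}"

definition quotient_topology :: "'x topology \<Rightarrow> ('x \<Rightarrow> 'x \<Rightarrow> bool) \<Rightarrow> 'x set topology" where
  "quotient_topology X r = topology (\<lambda>U. U \<subseteq> quotient_class r ` topspace X \<and>
     openin X {a \<in> topspace X. quotient_class r a \<in> U})"

lemma istopology_quotient_topology: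
  "istopology (\<lambda>U. U \<subseteq> quotient_class r ` topspace X \<and>
     openin X {a \<in> topspace X. quotient_class r a \<in> U})"
proof -
  have 1: "{a \<in> topspace X. quotient_class r a \<in> S \<inter> T} =
      {a \<in> topspace X. quotient_class r a \<in> S} \<inter> {a \<in> topspace X. quotient_class r a \<in> T}" for S T
    by auto
  have 2: "{a \<in> topspace X. quotient_class r a \<in> \<Union>\<K>} =
      (\<Union>K\<in>\<K>. {a \<in> topspace X. quotient_class r a \<in> K})" for \<K>
    by auto
  show ?thesis
    unfolding istopology_def 1 2 by blast
qed

lemma openin_quotient_topology:
  "openin (quotient_topology X r) U \<longleftrightarrow>
     U \<subseteq> quotient_class r ` topspace X \<and> openin X {a \<in> topspace X. quotient_class r a \<in> U}"
  by (simp add: quotient_topology_def istopology_quotient_topology)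

lemma topspace_quotient_topology [simp]:
  "topspace (quotient_topology X r) = quotient_class r ` topspace X"
proof -
  have "{a \<in> topspace X. quotient_class r a \<in> quotient_class r ` topspace X} = topspace X"
    by auto
  then have "openin (quotient_topology X r) (quotient_class r ` topspace X)"
    by (simp add: openin_quotient_topology)
  then show ?thesis
    by (meson openin_quotient_topology openin_subset openin_topspace subset_antisym)
qed

lemma quotient_map_quotient_class:
  "quotient_map X (quotient_topology X r) (quotient_class r)"
  by (auto simp: quotient_map_def openin_quotient_topology)

lemma quotient_class_eq:
  assumes "r a b"
  shows "quotient_class r a = quotient_class r b"
proof -
  have "equivclp r a b"
    using assms by blast
  then have "equivclp r a c \<longleftrightarrow> equivclp r b c" for c
    by (meson equivclp_sym equivclp_trans)
  then show ?thesis
    by (simp add: quotient_class_def)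
qed

lemma quotient_class_invariant:
  assumes "\<And>a b. r a b \<Longrightarrow> g a = g b"
  shows "g ` quotient_class r a = {g a}"
proof -
  have "g b = g a" if "equivclp r a b" for b
    using that
  proof (induction rule: equivclp_induct)
    case base
    then show ?case by simp
  next
    case (step y z)
    then show ?case using assms by metis
  qed
  moreover have "equivclp r a a"
    by simp
  ultimately show ?thesis
    unfolding quotient_class_def by blast
qed

text \<open>The realization of a cubical complex, using all face and degeneracy identifications.\<close>

inductive cubical_glue ::
    "'c cubical_complex \<Rightarrow> (nat \<times> 'c) \<times> (nat \<Rightarrow> real) \<Rightarrow> (nat \<times> 'c) \<times> (nat \<Rightarrow> real) \<Rightarrow> bool"
  for K where
  face: "c \<in> cubes K (Suc m) \<Longrightarrow> i \<in> {1..Suc m} \<Longrightarrow> x \<in> standard_cube m \<Longrightarrow>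
     cubical_glue K ((m, face K (Suc m) \<epsilon> i c), x) ((Suc m, c), cube_insert i (of_bool \<epsilon>) x)"
| degen: "c \<in> cubes K m \<Longrightarrow> i \<in> degen_index K m c \<Longrightarrow> x \<in> standard_cube (Suc m) \<Longrightarrow>
     cubical_glue K ((Suc m, degen K m i c), x) ((m, c), cube_delete i x)"

definition cubical_realization ::
    "'c cubical_complex \<Rightarrow> ((nat \<times> 'c) \<times> (nat \<Rightarrow> real)) set topology" where
  "cubical_realization K = quotient_topology
     (sum_topology (\<lambda>(m, c). cube_topology m) {(m, c). c \<in> cubes K m}) (cubical_glue K)"

definition cubical_cell ::
    "'c cubical_complex \<Rightarrow> nat \<Rightarrow> 'c \<Rightarrow> (nat \<Rightarrow> real) \<Rightarrow> ((nat \<times> 'c) \<times> (nat \<Rightarrow> real)) set" where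
  "cubical_cell K m c x = quotient_class (cubical_glue K) ((m, c), x)"

text \<open>\<open>\<parallel>S(B)\<parallel>\<close>: the realization of the singular simplicial set using face identifications only.\<close>

inductive simplicial_glue ::
    "'b topology \<Rightarrow> (nat \<times> ((nat \<Rightarrow> real) \<Rightarrow> 'b)) \<times> (nat \<Rightarrow> real)
       \<Rightarrow> (nat \<times> ((nat \<Rightarrow> real) \<Rightarrow> 'b)) \<times> (nat \<Rightarrow> real) \<Rightarrow> bool"
  for B where
  "singular_simplex (Suc p) B \<sigma> \<Longrightarrow> k \<le> Suc p \<Longrightarrow> x \<in> standard_simplex p \<Longrightarrow>
     simplicial_glue B ((p, singular_face (Suc p) k \<sigma>), x) ((Suc p, \<sigma>), simplical_face k x)"

type_synonym 'b fat_point = "((nat \<times> ((nat \<Rightarrow> real) \<Rightarrow> 'b)) \<times> (nat \<Rightarrow> real)) set"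

definition fat_realization :: "'b topology \<Rightarrow> 'b fat_point topology" where
  "fat_realization B = quotient_topology
     (sum_topology (\<lambda>(p, \<sigma>). subtopology (powertop_real UNIV) (standard_simplex p))
        {(p, \<sigma>). singular_simplex p B \<sigma>})
     (simplicial_glue B)"

definition fat_cell ::
    "'b topology \<Rightarrow> nat \<Rightarrow> ((nat \<Rightarrow> real) \<Rightarrow> 'b) \<Rightarrow> (nat \<Rightarrow> real) \<Rightarrow> 'b fat_point" where
  "fat_cell B p \<sigma> x = quotient_class (simplicial_glue B) ((p, \<sigma>), x)"

definition fat_skeleton :: "nat \<Rightarrow> 'b topology \<Rightarrow> 'b fat_point set" where
  "fat_skeleton n B =
    {fat_cell B p \<sigma> x | p \<sigma> x. p \<le> n \<and> singular_simplex p B \<sigma> \<and> x \<in> standard_simplex p}"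

text \<open>The canonical map \<open>\<parallel>S(B)\<parallel> \<rightarrow> B\<close>, which sends the class of \<open>((p, \<sigma>), x)\<close> to \<open>\<sigma> x\<close>.\<close>

definition fat_eval :: "'b fat_point \<Rightarrow> 'b" where
  "fat_eval y = the_elem ((\<lambda>((p, \<sigma>), x). \<sigma> x) ` y)"

lemma fat_eval_fat_cell: "fat_eval (fat_cell B p \<sigma> x) = \<sigma> x"
proof -
  let ?g = "\<lambda>((p::nat, \<sigma>::(nat \<Rightarrow> real) \<Rightarrow> 'a), x). \<sigma> x"
  have "?g a = ?g b" if "simplicial_glue B a b" for a b
    using that by cases (auto simp: singular_face_def)
  then have "?g ` quotient_class (simplicial_glue B) ((p, \<sigma>), x) = {?g ((p, \<sigma>), x)}"
    by (rule quotient_class_invariant)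
  then show ?thesis
    by (simp add: fat_eval_def fat_cell_def)
qed

text \<open>The map \<open>I\<^sup>p \<rightarrow> \<Delta>\<^sub>p\<close> and the map \<open>\<alpha>\<close> it induces.\<close>

definition cube_to_simplex :: "nat \<Rightarrow> (nat \<Rightarrow> real) \<Rightarrow> nat \<Rightarrow> real" where
  "cube_to_simplex p x = (\<lambda>j. if j < p then (\<Prod>i=1..j. x i) * (1 - x (Suc j))
     else if j = p then (\<Prod>i=1..p. x i) else 0)"

definition model_to_base ::
    "'b topology \<Rightarrow> ((nat \<times> ('b, 'a) model_cube) \<times> (nat \<Rightarrow> real)) set \<Rightarrow> 'b fat_point" where
  "model_to_base B y =
    the_elem ((\<lambda>((m, ((p, \<sigma>), (q, \<tau>))), x). fat_cell B p \<sigma> (cube_to_simplex p x)) ` y)"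

lemma simplicial_glue_cell:
  assumes "singular_simplex (Suc p) B \<sigma>" "k \<le> Suc p" "x \<in> standard_simplex p"
  shows "fat_cell B p (singular_face (Suc p) k \<sigma>) x = fat_cell B (Suc p) \<sigma> (simplical_face k x)"
  unfolding fat_cell_def using assms by (intro quotient_class_eq simplicial_glue.intros)

lemma cube_to_simplex_sum: "(\<Sum>j\<le>p. cube_to_simplex p x j) = 1"
proof -
  have "(\<Sum>j<k. (\<Prod>i=1..j. x i) * (1 - x (Suc j))) = 1 - (\<Prod>i=1..k. x i)" for k
    by (induction k) (auto simp: algebra_simps)
  moreover have "(\<Sum>j<p. cube_to_simplex p x j) = (\<Sum>j<p. (\<Prod>i=1..j. x i) * (1 - x (Suc j)))"
    by (rule sum.cong) (auto simp: cube_to_simplex_def)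
  ultimately show ?thesis
    by (simp add: lessThan_Suc_atMost [symmetric] cube_to_simplex_def)
qed

lemma cube_to_simplex_in_simplex:
  assumes "x \<in> standard_cube m"
  shows "cube_to_simplex p x \<in> standard_simplex p"
proof -
  have x: "0 \<le> x i" "x i \<le> 1" for i
    using assms by (auto simp: standard_cube_def)
  then have "0 \<le> cube_to_simplex p x i \<and> cube_to_simplex p x i \<le> 1" for i
    by (auto simp: cube_to_simplex_def intro!: prod_nonneg prod_le_1 mult_nonneg_nonneg mult_le_one)
  then show ?thesis
    using cube_to_simplex_sum [of p x]
    by (auto simp: standard_simplex_def cube_to_simplex_def)
qed

lemma front_face_eq_restrict:
  assumes "0 < i"
  shows "vertex_face \<sigma> [0..<i] = restrict \<sigma> (standard_simplex (i - 1))"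
proof -
  have "oriented_simplex (i - 1) (\<lambda>a j. if j = [0..<i] ! a then 1 else 0) x = x"
    if x: "x \<in> standard_simplex (i - 1)" for x
  proof
    fix j
    have "(\<Sum>a\<le>i - 1. (if j = [0..<i] ! a then 1 else 0) * x a) = (\<Sum>a\<le>i - 1. if a = j then x a else 0)"
      using assms by (intro sum.cong) auto
    also have "\<dots> = x j"
      using x by (auto simp: standard_simplex_def)
    finally show "oriented_simplex (i - 1) (\<lambda>a j. if j = [0..<i] ! a then 1 else 0) x j = x j"
      using x by (simp add: oriented_simplex_def)
  qed
  then show ?thesis
    by (auto simp: vertex_face_def simplex_map_def restrict_def)
qed

lemma simplical_face_top:
  assumes "x \<in> standard_simplex p"
  shows "simplical_face (Suc p) x = x"
  using assms by (auto simp: standard_simplex_def simplical_face_def)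

lemma standard_simplex_mono: "p \<le> q \<Longrightarrow> standard_simplex p \<subseteq> standard_simplex q"
proof
  fix x assume "p \<le> q" "x \<in> standard_simplex p"
  then show "x \<in> standard_simplex q"
    using sum.mono_neutral_right [of "{..q}" "{..p}" x] by (auto simp: standard_simplex_def)
qed

lemma fat_cell_front_face:
  assumes "singular_simplex p B \<sigma>" "k \<le> p" "x \<in> standard_simplex k"
  shows "fat_cell B k (restrict \<sigma> (standard_simplex k)) x = fat_cell B p \<sigma> x"
  using assms
proof (induction p arbitrary: \<sigma>)
  case 0
  then show ?case
    by (simp add: singular_simplex_def extensional_restrict)
next
  case (Suc p)
  show ?case
  proof (cases "k = Suc p")
    case True
    with Suc.prems show ?thesis
      by (simp add: singular_simplex_def extensional_restrict)
  next
    case False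
    with Suc.prems have k: "k \<le> p" by simp
    have mono: "standard_simplex k \<subseteq> standard_simplex p"
      using k by (rule standard_simplex_mono)
    have face: "singular_face (Suc p) (Suc p) \<sigma> = restrict \<sigma> (standard_simplex p)"
      by (auto simp: singular_face_def simplical_face_top restrict_def)
    have "singular_simplex p B (singular_face (Suc p) (Suc p) \<sigma>)"
      using singular_simplex_singular_face [OF Suc.prems(1), of "Suc p"] by simp
    then have "fat_cell B k (restrict \<sigma> (standard_simplex k)) x
        = fat_cell B p (singular_face (Suc p) (Suc p) \<sigma>) x"
      using Suc.IH [of "singular_face (Suc p) (Suc p) \<sigma>"] k Suc.prems mono
      by (simp add: face inf.absorb2 del: restrict_apply)
    also have "\<dots> = fat_cell B (Suc p) \<sigma> x"
      using Suc.prems mono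
      by (subst simplicial_glue_cell) (auto simp: simplical_face_top)
    finally show ?thesis .
  qed
qed

lemma cube_to_simplex_insert_one:
  assumes "1 \<le> i" "i \<le> Suc p"
  shows "simplical_face (i - 1) (cube_to_simplex p x) = cube_to_simplex (Suc p) (cube_insert i 1 x)"
proof
  have low: "(\<Prod>l=1..j. cube_insert i 1 x l) = (\<Prod>l=1..j. x l)" if "j < i" for j
    using that by (intro prod.cong) (auto simp: cube_insert_def)
  have high: "(\<Prod>l=1..Suc j. cube_insert i 1 x l) = (\<Prod>l=1..j. x l)" if "i \<le> Suc j" for j
    using that
  proof (induction j)
    case 0
    then show ?case using assms by (simp add: cube_insert_def)
  next
    case (Suc j)
    show ?case
    proof (cases "i = Suc (Suc j)")
      case True
      then show ?thesis
        using low [of "Suc j"] by (simp add: cube_insert_def)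
    next
      case False
      with Suc.prems have "i \<le> Suc j" by simp
      with Suc.IH False Suc.prems show ?thesis
        by (simp add: cube_insert_def)
    qed
  qed
  fix j
  consider "j < i - 1" | "j = i - 1" | "i \<le> j"
    by linarith
  then show "simplical_face (i - 1) (cube_to_simplex p x) j = cube_to_simplex (Suc p) (cube_insert i 1 x) j"
  proof cases
    case 1
    then show ?thesis
      using assms low [of j] by (auto simp: simplical_face_def cube_to_simplex_def cube_insert_def)
  next
    case 2
    then show ?thesis
      using assms by (auto simp: simplical_face_def cube_to_simplex_def cube_insert_def)
  next
    case 3
    then obtain j' where "j = Suc j'"
      using assms by (cases j) auto
    with 3 show ?thesis
      using assms high [of j'] by (auto simp: simplical_face_def cube_to_simplex_def cube_insert_def)
  qed
qed

lemma cube_to_simplex_insert_zero: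
  assumes "1 \<le> i" "i \<le> Suc p"
  shows "cube_to_simplex (Suc p) (cube_insert i 0 x) = cube_to_simplex (i - 1) x"
proof
  have low: "(\<Prod>l=1..j. cube_insert i 0 x l) = (\<Prod>l=1..j. x l)" if "j < i" for j
    using that by (intro prod.cong) (auto simp: cube_insert_def)
  have high: "(\<Prod>l=1..j. cube_insert i 0 x l) = 0" if "i \<le> j" for j
    using that assms by (intro prod_zero) (auto simp: cube_insert_def)
  fix j
  show "cube_to_simplex (Suc p) (cube_insert i 0 x) j = cube_to_simplex (i - 1) x j"
    using assms low [of j] high [of j] high [of "Suc p"]
    by (cases "j < i - 1"; cases "j = i - 1")
       (auto simp: cube_to_simplex_def cube_insert_def)
qed

lemma cube_to_simplex_cong:
  "(\<And>i. 1 \<le> i \<Longrightarrow> i \<le> p \<Longrightarrow> x i = y i) \<Longrightarrow> cube_to_simplex p x = cube_to_simplex p y"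
  by (auto simp: cube_to_simplex_def fun_eq_iff intro!: prod.cong arg_cong2 [where f = times])

lemma model_to_base_cell:
  "model_to_base B (cubical_cell (twisted_product B n z) m ((p, \<sigma>), (q, \<tau>)) x)
     = fat_cell B p \<sigma> (cube_to_simplex p x)"
proof -
  let ?K = "twisted_product B n z"
  let ?g = "\<lambda>((m::nat, ((p, \<sigma>), (q::nat, \<tau>::(nat \<Rightarrow> interval_cell) \<Rightarrow> 'b))), x).
    fat_cell B p \<sigma> (cube_to_simplex p x)"
  have "?g a = ?g b" if "cubical_glue ?K a b" for a b
    using that
  proof cases
    case (face c m i x \<epsilon>)
    obtain p \<sigma> q \<tau> where c: "c = ((p, \<sigma>), (q, \<tau>))"
      by (metis surj_pair)
    with face have pq: "p + q = Suc m" and \<sigma>: "singular_simplex p B \<sigma>"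
      by (auto simp: twisted_product_def)
    show ?thesis
    proof (cases "p < i")
      case True
      have "cube_to_simplex p (cube_insert i (of_bool \<epsilon>) x) = cube_to_simplex p x"
        using True by (intro cube_to_simplex_cong) (auto simp: cube_insert_def)
      with True face c show ?thesis
        by (simp add: twisted_product_def)
    next
      case False
      with face obtain p' where p: "p = Suc p'" and i: "1 \<le> i" "i \<le> Suc p'"
        by (cases p) auto
      have \<sigma>': "singular_simplex (Suc p') B \<sigma>"
        using \<sigma> p by simp
      show ?thesis
      proof (cases \<epsilon>)
        case True
        then show ?thesis
          using face c p i simplicial_glue_cell [OF \<sigma>', of "i - 1" "cube_to_simplex p' x"]
            cube_to_simplex_in_simplex [of x m p'] cube_to_simplex_insert_one [OF i, of x]
          by (simp add: twisted_product_def)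
      next
        case eps: False
        have face': "singular_face (Suc p') (Suc p') \<sigma> = restrict \<sigma> (standard_simplex p')"
          by (auto simp: singular_face_def simplical_face_top restrict_def)
        have "fat_cell B (i - 1) (restrict \<sigma> (standard_simplex (i - 1))) (cube_to_simplex (i - 1) x)
            = fat_cell B p \<sigma> (cube_to_simplex p (cube_insert i 0 x))"
          using face p i fat_cell_front_face [OF \<sigma>', of "i - 1" "cube_to_simplex (i - 1) x"]
            cube_to_simplex_in_simplex [of x m "i - 1"] cube_to_simplex_insert_zero [OF i, of x]
          by simp
        with eps face c p i show ?thesis
          by (cases "i = Suc p'") (auto simp: twisted_product_def front_face_eq_restrict face')
      qed
    qed
  next
    case (degen c m i x)
    obtain p \<sigma> q \<tau> where c: "c = ((p, \<sigma>), (q, \<tau>))"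
      by (metis surj_pair)
    with degen have "p < i"
      by (auto simp: twisted_product_def)
    then have "cube_to_simplex p (cube_delete i x) = cube_to_simplex p x"
      by (intro cube_to_simplex_cong) (auto simp: cube_delete_def)
    with degen c show ?thesis
      by (simp add: twisted_product_def)
  qed
  then have "?g ` quotient_class (cubical_glue ?K) ((m, ((p, \<sigma>), (q, \<tau>))), x)
      = {?g ((m, ((p, \<sigma>), (q, \<tau>))), x)}"
    by (rule quotient_class_invariant)
  then show ?thesis
    by (simp add: model_to_base_def cubical_cell_def)
qed


section \<open>Homotopy groups and fibrations\<close>

definition spheroid :: "nat \<Rightarrow> 'x topology \<Rightarrow> 'x \<Rightarrow> ((nat \<Rightarrow> real) \<Rightarrow> 'x) \<Rightarrow> bool" where
  "spheroid n X e \<gamma> \<longleftrightarrow> continuous_map (cube_topology n) X \<gamma> \<and>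
     \<gamma> \<in> extensional (standard_cube n) \<and> (\<forall>x\<in>cube_boundary n. \<gamma> x = e)"

definition spheroid_class ::
    "nat \<Rightarrow> 'x topology \<Rightarrow> 'x \<Rightarrow> ((nat \<Rightarrow> real) \<Rightarrow> 'x) \<Rightarrow> ((nat \<Rightarrow> real) \<Rightarrow> 'x) set" where
  "spheroid_class n X e \<gamma> = {\<gamma>'. spheroid n X e \<gamma>' \<and>
     homotopic_with (\<lambda>h. \<forall>x\<in>cube_boundary n. h x = e) (cube_topology n) X \<gamma> \<gamma>'}"

definition spheroid_join ::
    "nat \<Rightarrow> ((nat \<Rightarrow> real) \<Rightarrow> 'x) \<Rightarrow> ((nat \<Rightarrow> real) \<Rightarrow> 'x) \<Rightarrow> (nat \<Rightarrow> real) \<Rightarrow> 'x" where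
  "spheroid_join n \<gamma> \<gamma>' = (\<lambda>x\<in>standard_cube n.
     if x 1 \<le> 1 / 2 then \<gamma> (x(1 := 2 * x 1)) else \<gamma>' (x(1 := 2 * x 1 - 1)))"

text \<open>\<open>\<pi>\<^sub>n(X,e)\<close> for \<open>n \<ge> 1\<close>.\<close>

definition homotopy_group ::
    "nat \<Rightarrow> 'x topology \<Rightarrow> 'x \<Rightarrow> ((nat \<Rightarrow> real) \<Rightarrow> 'x) set monoid" where
  "homotopy_group n X e = \<lparr>
     carrier = spheroid_class n X e ` Collect (spheroid n X e),
     monoid.mult = (\<lambda>A C. \<Union>\<gamma>\<in>A. \<Union>\<gamma>'\<in>C. spheroid_class n X e (spheroid_join n \<gamma> \<gamma>')),
     one = spheroid_class n X e (\<lambda>x\<in>standard_cube n. e)\<rparr>"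

definition additive_group :: "'a::ab_group_add itself \<Rightarrow> 'a monoid" where
  "additive_group _ = \<lparr>carrier = UNIV, monoid.mult = (+), one = 0\<rparr>"

definition eilenberg_maclane_space :: "'a::ab_group_add itself \<Rightarrow> nat \<Rightarrow> 'x topology \<Rightarrow> bool" where
  "eilenberg_maclane_space A n X \<longleftrightarrow> topspace X \<noteq> {} \<and> path_connected_space X \<and>
     (\<forall>e\<in>topspace X. additive_group A \<cong> homotopy_group n X e \<and>
        (\<forall>k\<ge>1. k \<noteq> n \<longrightarrow> carrier (homotopy_group k X e) = {one (homotopy_group k X e)}))"

definition serre_fibration :: "'e topology \<Rightarrow> 'b topology \<Rightarrow> ('e \<Rightarrow> 'b) \<Rightarrow> bool" where
  "serre_fibration E B p \<longleftrightarrow> continuous_map E B p \<and>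
     (\<forall>m h H. continuous_map (cube_topology m) E h \<and>
        continuous_map (prod_topology (top_of_set {0..1::real}) (cube_topology m)) B H \<and>
        (\<forall>x\<in>standard_cube m. H (0, x) = p (h x)) \<longrightarrow>
        (\<exists>G. continuous_map (prod_topology (top_of_set {0..1::real}) (cube_topology m)) E G \<and>
           (\<forall>x\<in>standard_cube m. G (0, x) = h x) \<and>
           (\<forall>t\<in>{0..1}. \<forall>x\<in>standard_cube m. p (G (t, x)) = H (t, x))))"

definition fibre :: "'e topology \<Rightarrow> ('e \<Rightarrow> 'b) \<Rightarrow> 'b \<Rightarrow> 'e topology" where
  "fibre E p b = subtopology E {e \<in> topspace E. p e = b}"

text \<open>Obstruction theory with coefficients in the group \<open>\<pi>\<close> (rather than in a local system) presupposes
  identifications \<open>\<theta> e : \<pi> \<cong> \<pi>\<^sub>n(F, e)\<close>, for \<open>F\<close> the fibre through \<open>e\<close>, that are compatible with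
  transport along paths of base points in \<open>E\<close>.\<close>

definition fibre_identification :: "nat \<Rightarrow> 'e topology \<Rightarrow> ('e \<Rightarrow> 'b)
    \<Rightarrow> ('e \<Rightarrow> 'a::ab_group_add \<Rightarrow> ((nat \<Rightarrow> real) \<Rightarrow> 'e) set) \<Rightarrow> bool" where
  "fibre_identification n E p \<theta> \<longleftrightarrow>
     (\<forall>e\<in>topspace E.
        \<theta> e \<in> iso (additive_group TYPE('a)) (homotopy_group n (fibre E p (p e)) e)) \<and>
     (\<forall>H \<gamma> g. continuous_map (prod_topology (top_of_set {0..1::real}) (cube_topology n)) E H \<and>
        (\<forall>t\<in>{0..1}. (\<forall>x\<in>standard_cube n. p (H (t, x)) = p (\<gamma> t)) \<and>
                    (\<forall>x\<in>cube_boundary n. H (t, x) = \<gamma> t)) \<and>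
        restrict (\<lambda>x. H (0, x)) (standard_cube n) \<in> \<theta> (\<gamma> 0) g
      \<longrightarrow> restrict (\<lambda>x. H (1, x)) (standard_cube n) \<in> \<theta> (\<gamma> 1) g)"


section \<open>Sections over the skeleton and the obstruction class\<close>

text \<open>\<open>E'\<close>, the pull-back of \<open>E \<rightarrow> B\<close> along \<open>\<parallel>S(B)\<parallel> \<rightarrow> B\<close>.\<close>

definition pullback_space ::
    "'e topology \<Rightarrow> 'b topology \<Rightarrow> ('e \<Rightarrow> 'b) \<Rightarrow> ('b fat_point \<times> 'e) topology" where
  "pullback_space E B p = subtopology (prod_topology (fat_realization B) E)
     {(y, e). y \<in> topspace (fat_realization B) \<and> e \<in> topspace E \<and> fat_eval y = p e}"

definition skeleton_section :: "nat \<Rightarrow> 'e topology \<Rightarrow> 'b topology \<Rightarrow> ('e \<Rightarrow> 'b)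
    \<Rightarrow> ('b fat_point \<Rightarrow> 'b fat_point \<times> 'e) \<Rightarrow> bool" where
  "skeleton_section n E B p s \<longleftrightarrow>
     continuous_map (subtopology (fat_realization B) (fat_skeleton n B)) (pullback_space E B p) s \<and>
     (\<forall>y\<in>fat_skeleton n B. fst (s y) = y)"

definition section_base_point ::
    "'b topology \<Rightarrow> ('b fat_point \<Rightarrow> 'b fat_point \<times> 'e) \<Rightarrow> nat \<Rightarrow> ((nat \<Rightarrow> real) \<Rightarrow> 'b) \<Rightarrow> 'e" where
  "section_base_point B s k \<sigma> = snd (s (fat_cell B k \<sigma> (\<lambda>i. if i = 0 then 1 else 0)))"

text \<open>The value on \<open>\<sigma>\<close> of the obstruction cocycle of \<open>s\<close> is the class of \<open>s\<bar>\<partial>\<sigma>\<close> in \<open>\<pi>\<^sub>n\<close> of the fibre,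
  obtained by deforming \<open>s\<bar>\<partial>\<sigma>\<close> over \<open>\<sigma>\<close> into the fibre over the leading vertex. Parametrize \<open>\<sigma>\<close> by
  \<open>I\<^bsup>n+1\<^esup> \<rightarrow> \<Delta>\<^bsub>n+1\<^esub>\<close>, which collapses the face \<open>x\<^sub>1 = 0\<close> to that vertex. A lift \<open>G\<close> over \<open>\<sigma>\<close> which agrees
  with \<open>s\<close> on all other faces exists by the homotopy lifting property, and its restriction to the
  face \<open>x\<^sub>1 = 0\<close> represents the obstruction. This fixes the sign: it is the one for which \<open>f\<close> below
  extends over the cells \<open>(\<sigma>\<^bsup>n+1\<^esup>, \<tau>\<^sup>0)\<close>, where \<open>d\<^sub>1\<^sup>0(\<sigma>, \<tau>) = (\<sigma>\<^bsub>[0]\<^esub>, \<kappa>\<^sub>z(\<sigma>))\<close>.\<close>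

definition obstruction_cocycle :: "nat \<Rightarrow> 'e topology \<Rightarrow> 'b topology \<Rightarrow> ('e \<Rightarrow> 'b)
    \<Rightarrow> ('e \<Rightarrow> 'a::ab_group_add \<Rightarrow> ((nat \<Rightarrow> real) \<Rightarrow> 'e) set)
    \<Rightarrow> ('b fat_point \<Rightarrow> 'b fat_point \<times> 'e) \<Rightarrow> (((nat \<Rightarrow> real) \<Rightarrow> 'b) \<Rightarrow> 'a) \<Rightarrow> bool" where
  "obstruction_cocycle n E B p \<theta> s z \<longleftrightarrow> z \<in> singular_cocycles (Suc n) B \<and>
     (\<forall>\<sigma>. singular_simplex (Suc n) B \<sigma> \<longrightarrow>
        (\<exists>G. continuous_map (cube_topology (Suc n)) (pullback_space E B p) G \<and>
          (\<forall>x\<in>standard_cube (Suc n).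
             fst (G x) = fat_cell B (Suc n) \<sigma> (cube_to_simplex (Suc n) x)) \<and>
          (\<forall>x\<in>standard_cube (Suc n).
             (\<exists>i\<in>{1..Suc n}. x i = 1 \<or> (x i = 0 \<and> i \<noteq> 1)) \<longrightarrow>
             G x = s (fat_cell B (Suc n) \<sigma> (cube_to_simplex (Suc n) x))) \<and>
          restrict (\<lambda>x. snd (G (cube_insert 1 0 x))) (standard_cube n)
            \<in> \<theta> (section_base_point B s (Suc n) \<sigma>) (z \<sigma>)))"

definition in_obstruction_class :: "nat \<Rightarrow> 'e topology \<Rightarrow> 'b topology \<Rightarrow> ('e \<Rightarrow> 'b)
    \<Rightarrow> ('e \<Rightarrow> 'a::ab_group_add \<Rightarrow> ((nat \<Rightarrow> real) \<Rightarrow> 'e) set)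
    \<Rightarrow> (((nat \<Rightarrow> real) \<Rightarrow> 'b) \<Rightarrow> 'a) \<Rightarrow> bool" where
  "in_obstruction_class n E B p \<theta> z \<longleftrightarrow> z \<in> singular_cocycles (Suc n) B \<and>
     (\<exists>s z' c. skeleton_section n E B p s \<and> obstruction_cocycle n E B p \<theta> s z' \<and>
        (\<forall>\<sigma>. singular_simplex (Suc n) B \<sigma> \<longrightarrow> z \<sigma> = z' \<sigma> + singular_coboundary n c \<sigma>))"


section \<open>The canonical cochain map\<close>

definition model_comparison :: "nat \<Rightarrow> 'e topology \<Rightarrow> 'b topology \<Rightarrow> ('e \<Rightarrow> 'b)
    \<Rightarrow> ('e \<Rightarrow> 'a::ab_group_add \<Rightarrow> ((nat \<Rightarrow> real) \<Rightarrow> 'e) set)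
    \<Rightarrow> (((nat \<Rightarrow> real) \<Rightarrow> 'b) \<Rightarrow> 'a) \<Rightarrow> ('b fat_point \<Rightarrow> 'b fat_point \<times> 'e)
    \<Rightarrow> (((nat \<times> ('b, 'a) model_cube) \<times> (nat \<Rightarrow> real)) set \<Rightarrow> 'b fat_point \<times> 'e) \<Rightarrow> bool" where
  "model_comparison n E B p \<theta> z s f \<longleftrightarrow>
     (let K = twisted_product B n z in
       continuous_map (cubical_realization K) (pullback_space E B p) f \<and>
       (\<forall>y\<in>topspace (cubical_realization K). fst (f y) = model_to_base B y) \<and>
       (\<forall>k \<sigma> q \<tau>. k + q \<le> n \<and> \<not> (k = 0 \<and> q = n) \<and> ((k, \<sigma>), (q, \<tau>)) \<in> cubes K (k + q) \<longrightarrow>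
          (\<forall>x\<in>standard_cube (k + q).
             f (cubical_cell K (k + q) ((k, \<sigma>), (q, \<tau>)) x)
               = s (model_to_base B (cubical_cell K (k + q) ((k, \<sigma>), (q, \<tau>)) x)))) \<and>
       (\<forall>\<sigma> \<tau>. ((0, \<sigma>), (n, \<tau>)) \<in> cubes K n \<longrightarrow>
          restrict (\<lambda>x. snd (f (cubical_cell K n ((0, \<sigma>), (n, \<tau>)) x))) (standard_cube n)
            \<in> \<theta> (section_base_point B s 0 \<sigma>) (\<tau> (top_cell n))))"

definition comparison_cube :: "'c cubical_complex \<Rightarrow> (((nat \<times> 'c) \<times> (nat \<Rightarrow> real)) set \<Rightarrow> 'y \<times> 'e)
    \<Rightarrow> nat \<Rightarrow> 'c \<Rightarrow> (nat \<Rightarrow> real) \<Rightarrow> 'e" where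
  "comparison_cube K f m c = restrict (\<lambda>x. snd (f (cubical_cell K m c x))) (standard_cube m)"

text \<open>The canonical cochain map depends on the choices of \<open>s\<close> and \<open>f\<close>.\<close>

definition canonical_cochain_map :: "nat \<Rightarrow> 'e topology \<Rightarrow> 'b topology \<Rightarrow> ('e \<Rightarrow> 'b)
    \<Rightarrow> ('e \<Rightarrow> 'a::ab_group_add \<Rightarrow> ((nat \<Rightarrow> real) \<Rightarrow> 'e) set)
    \<Rightarrow> (((nat \<Rightarrow> real) \<Rightarrow> 'b) \<Rightarrow> 'a)
    \<Rightarrow> (nat \<Rightarrow> (((nat \<Rightarrow> real) \<Rightarrow> 'e) \<Rightarrow> 'l::comm_ring_1) \<Rightarrow> ('b, 'a) model_cube \<Rightarrow> 'l) \<Rightarrow> bool" where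
  "canonical_cochain_map n E B p \<theta> z \<phi> \<longleftrightarrow>
     (\<exists>s f. skeleton_section n E B p s \<and> obstruction_cocycle n E B p \<theta> s z \<and>
        model_comparison n E B p \<theta> z s f \<and>
        \<phi> = induced_cochain_map (twisted_product B n z) (comparison_cube (twisted_product B n z) f))"

end

theory Submission
  imports Defs
begin

text \<open>The cochain map is induced by the assignment which sends a cube of \<open>S(B) \<times>\<^sub>z L(\<pi>,n)\<close> to its
  characteristic map into the realization followed by \<open>f\<close> and the projection to \<open>E\<close>. The
  realization glues a cube to its faces and degeneracies, so this assignment commutes with
  all the \<open>d\<^sub>i\<^sup>\<epsilon>\<close> and \<open>s\<^sub>i\<close> (\<open>comparison_cube_map\<close>). The differential and the Serre cup product are given
  by the same universal formulas in iterated faces on both sides, hence any map of cubical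
  complexes is compatible with them, on the level of cochains and not only up to homotopy
  (\<open>cochain_map_induced\<close>, \<open>multiplicative_induced\<close>).

  What has to be proved about the model is that it is closed under its face operators. A face
  \<open>d\<^sub>i\<^sup>0\<close> with \<open>i < p\<close> brings in the cochain \<open>\<kappa>\<^sub>z(\<sigma>)\<close> of a cube, and the cochain map can be evaluated on
  that face only if \<open>\<kappa>\<^sub>z(\<sigma>)\<close> is a cocycle. This is where \<open>\<delta>z = 0\<close> enters (\<open>kappa_cocycle\<close>). Let \<open>w\<close> be
  an \<open>(n+1)\<close>-cell with free coordinates \<open>i\<^sub>0 < \<dots> < i\<^sub>n\<close>. If a coordinate of \<open>w\<close> strictly between \<open>i\<^sub>0\<close>
  and \<open>i\<^sub>n\<close> is fixed at \<open>0\<close>, then \<open>\<kappa>\<^sub>z(\<sigma>)\<close> takes the same value on any two opposite faces of \<open>w\<close>, and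
  its coboundary on \<open>w\<close> vanishes term by term. Otherwise let \<open>r\<close> and \<open>q\<close> be the zeros of \<open>w\<close> next to
  the free coordinates. Among the faces where some \<open>i\<^sub>j\<close> is set to \<open>0\<close> only \<open>j = 0\<close> and \<open>j = n\<close>
  contribute, and they yield \<open>z\<close> on the faces of the simplex \<open>[r, i\<^sub>0, \<dots>, i\<^sub>n, q]\<close> omitting \<open>r\<close> and \<open>q\<close>;
  the face where \<open>i\<^sub>j\<close> is set to \<open>1\<close> yields the one omitting \<open>i\<^sub>j\<close>. Altogether this is \<open>- \<delta>z\<close> on
  that simplex.\<close>

section \<open>Maps of cubical complexes induce multiplicative cochain maps\<close>

text \<open>Closure of \<open>L\<close> under faces is an assumption because the induced cochains are extended by zero
  outside the cubes of \<open>L\<close>, so a face which is not a cube would drop out of the coboundary although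
  its image contributes to the coboundary in \<open>K\<close>.\<close>

locale cubical_map =
  fixes L :: "'d cubical_complex" and K :: "'c cubical_complex" and F :: "nat \<Rightarrow> 'd \<Rightarrow> 'c"
  assumes face_cube: "c \<in> cubes L (Suc m) \<Longrightarrow> i \<in> {1..Suc m} \<Longrightarrow> face L (Suc m) \<epsilon> i c \<in> cubes L m"
    and map_cube: "c \<in> cubes L m \<Longrightarrow> F m c \<in> cubes K m"
    and map_face: "c \<in> cubes L (Suc m) \<Longrightarrow> i \<in> {1..Suc m} \<Longrightarrow>
      F m (face L (Suc m) \<epsilon> i c) = face K (Suc m) \<epsilon> i (F (Suc m) c)"
    and map_degen_index: "c \<in> cubes L m \<Longrightarrow> i \<in> degen_index L m c \<Longrightarrow> i \<in> degen_index K m (F m c)"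
    and map_degen: "c \<in> cubes L m \<Longrightarrow> i \<in> degen_index L m c \<Longrightarrow>
      F (Suc m) (degen L m i c) = degen K m i (F m c)"
begin

text \<open>The list is increasing and its last entry acts first, so an entry \<open>i\<close> is applied to a cube
  of dimension \<open>m\<close> minus the number of larger entries, which is at least \<open>i\<close>. Hence every face operator
  that occurs is an admissible one.\<close>

lemma faces_along_cube_map:
  assumes "c \<in> cubes L m" "sorted_wrt (<) is" "set is \<subseteq> {1..m}"
  shows "faces_along L m \<epsilon> is c \<in> cubes L (m - length is) \<and>
    F (m - length is) (faces_along L m \<epsilon> is c) = faces_along K m \<epsilon> is (F m c)"
  using assms(2,3)
proof (induction "is")
  case Nil
  then show ?case using assms(1) by simp
next
  case (Cons i js)
  have "set js \<subseteq> {Suc i..m}" "distinct js"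
    using Cons.prems by (auto simp: strict_sorted_iff Suc_le_eq)
  then have len: "length js \<le> m - i"
    by (metis card_atLeastAtMost card_mono diff_Suc_Suc distinct_card finite_atLeastAtMost)
  with Cons.prems have "i \<in> {1..m - length js}" by auto
  then obtain m' where m': "m - length js = Suc m'" "i \<in> {1..Suc m'}"
    by (cases "m - length js") auto
  then have last: "m - Suc (length js) = m'" by simp
  with Cons.IH Cons.prems show ?case
    using face_cube [of _ m' i \<epsilon>] map_face [of _ m' i \<epsilon>] m'(2)
    by (simp add: last m'(1))
qed

lemma multi_face_cube_map:
  assumes "c \<in> cubes L m" "S \<subseteq> {1..m}"
  shows "multi_face L m \<epsilon> S c \<in> cubes L (m - card S)"
    and "F (m - card S) (multi_face L m \<epsilon> S c) = multi_face K m \<epsilon> S (F m c)"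
proof -
  have "finite S" using assms(2) finite_subset by blast
  then show "multi_face L m \<epsilon> S c \<in> cubes L (m - card S)"
    and "F (m - card S) (multi_face L m \<epsilon> S c) = multi_face K m \<epsilon> S (F m c)"
    using faces_along_cube_map [OF assms(1), of "sorted_list_of_set S" \<epsilon>] assms(2)
    by (simp_all add: multi_face_def)
qed

lemma induced_normalized:
  assumes "x \<in> normalized_cochains K m"
  shows "induced_cochain_map L F m x \<in> normalized_cochains L m"
proof -
  have "x (F m c) = 0" if c: "c \<in> degenerate_cubes L m" for c
  proof -
    obtain k i c' where "m = Suc k" "c = degen L k i c'" "c' \<in> cubes L k" "i \<in> degen_index L k c'"
      using c by (auto simp: degenerate_cubes_def)
    then have "F m c = degen K k i (F k c')" "F k c' \<in> cubes K k" "i \<in> degen_index K k (F k c')"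
      by (auto simp: map_degen map_degen_index map_cube)
    with \<open>m = Suc k\<close> have "F m c \<in> degenerate_cubes K m"
      unfolding degenerate_cubes_def by blast
    then show ?thesis
      using assms by (auto simp: normalized_cochains_def)
  qed
  then show ?thesis
    by (auto simp: normalized_cochains_def induced_cochain_map_def)
qed

lemma induced_coboundary:
  "induced_cochain_map L F (Suc m) (cubical_coboundary K m x)
     = cubical_coboundary L m (induced_cochain_map L F m x)"
proof
  fix c
  show "induced_cochain_map L F (Suc m) (cubical_coboundary K m x) c
     = cubical_coboundary L m (induced_cochain_map L F m x) c"
  proof (cases "c \<in> cubes L (Suc m)")
    case True
    have "induced_cochain_map L F m x (face L (Suc m) \<epsilon> i c) = x (face K (Suc m) \<epsilon> i (F (Suc m) c))"
      if "i \<in> {1..Suc m}" for i \<epsilon>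
      using face_cube [OF True that] map_face [OF True that] by (simp add: induced_cochain_map_def)
    then have "(\<Sum>i=1..Suc m. (- 1) ^ i * induced_cochain_map L F m x (face L (Suc m) \<epsilon> i c))
        = (\<Sum>i=1..Suc m. (- 1) ^ i * x (face K (Suc m) \<epsilon> i (F (Suc m) c)))" for \<epsilon>
      by (intro sum.cong) auto
    with True map_cube [OF True] show ?thesis
      by (simp only: induced_cochain_map_def [of L F "Suc m"] cubical_coboundary_def if_True)
  qed (simp add: induced_cochain_map_def cubical_coboundary_def)
qed

lemma cochain_map_induced: "cochain_map K L (induced_cochain_map L F)"
  unfolding cochain_map_def
  by (intro allI ballI conjI induced_normalized induced_coboundary)
     (auto simp: induced_cochain_map_def)

lemma multiplicative_induced: "multiplicative K L (induced_cochain_map L F)"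
proof -
  have "induced_cochain_map L F (s + t) (serre_cup K s t x y) c
      = serre_cup L s t (induced_cochain_map L F s x) (induced_cochain_map L F t y) c" for s t x y c
  proof (cases "c \<in> cubes L (s + t)")
    case True
    let ?P = "{(H, L). H \<union> L = {1..s + t} \<and> H \<inter> L = {} \<and> card H = s \<and> card L = t}"
    have "x (multi_face K (s + t) False M (F (s + t) c))
          = induced_cochain_map L F s x (multi_face L (s + t) False M c)
        \<and> y (multi_face K (s + t) True H (F (s + t) c))
          = induced_cochain_map L F t y (multi_face L (s + t) True H c)" if "(H, M) \<in> ?P" for H M
    proof -
      have "H \<subseteq> {1..s + t}" "M \<subseteq> {1..s + t}" "s + t - card M = s" "s + t - card H = t"
        using that by auto
      then show ?thesis
        using multi_face_cube_map [OF True] by (metis induced_cochain_map_def)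
    qed
    then have "(\<Sum>(H, M)\<in>?P. (- 1) ^ card {(h, l). h \<in> H \<and> l \<in> M \<and> l < h}
          * x (multi_face K (s + t) False M (F (s + t) c)) * y (multi_face K (s + t) True H (F (s + t) c)))
        = (\<Sum>(H, M)\<in>?P. (- 1) ^ card {(h, l). h \<in> H \<and> l \<in> M \<and> l < h}
          * induced_cochain_map L F s x (multi_face L (s + t) False M c)
          * induced_cochain_map L F t y (multi_face L (s + t) True H c))"
      by (intro sum.cong) auto
    with True map_cube [OF True] show ?thesis
      by (simp only: induced_cochain_map_def [of L F "s + t"] serre_cup_def if_True)
  qed (simp add: induced_cochain_map_def serre_cup_def)
  then show ?thesis
    unfolding multiplicative_def by blast
qed

end


section \<open>Faces and products of cellular cocycles\<close>

lemma alt_sign_0 [simp]: "alt_sign k 0 = 0"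
  by (simp add: alt_sign_def)

lemma finite_free_coords: "w \<in> cube_cells q k \<Longrightarrow> finite (free_coords w)"
  by (rule finite_subset [of _ "{1..q}"]) (auto simp: cube_cells_def free_coords_def)

lemma free_coords_subset: "w \<in> cube_cells q k \<Longrightarrow> free_coords w \<subseteq> {1..q}"
  by (auto simp: cube_cells_def free_coords_def)

lemma free_coords_upd: "free_coords (w(i := Fixed e)) = free_coords w - {i}"
  by (auto simp: free_coords_def)

lemma cube_cells_upd:
  assumes "w \<in> cube_cells q (Suc k)" "i \<in> free_coords w"
  shows "w(i := Fixed e) \<in> cube_cells q k"
proof -
  have "i \<in> {1..q}" using assms free_coords_subset by blast
  then show ?thesis
    using assms by (auto simp: cube_cells_def free_coords_upd)
qed

text \<open>The sign attached to a free coordinate depends only on its rank among the free coordinates, and an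
  increasing renumbering preserves ranks. The coboundary sum on a cell can thus be computed in
  any increasing numbering of its free coordinates.\<close>

lemma alternating_sum_reindex:
  fixes g :: "nat \<Rightarrow> nat" and D :: "nat \<Rightarrow> 'a::ab_group_add"
  assumes "strict_mono_on V g"
  shows "(\<Sum>i\<in>g ` V. alt_sign (card {k \<in> g ` V. k \<le> i}) (D i))
    = (\<Sum>i\<in>V. alt_sign (card {k \<in> V. k \<le> i}) (D (g i)))"
proof -
  have inj: "inj_on g V" using assms by (rule strict_mono_on_imp_inj_on)
  have "card {k \<in> g ` V. k \<le> g i} = card {k \<in> V. k \<le> i}" if "i \<in> V" for i
  proof -
    have "{k \<in> g ` V. k \<le> g i} = g ` {k \<in> V. k \<le> i}"
      using strict_mono_on_leD [OF assms] strict_mono_on_less_eq [OF assms] that by auto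
    then show ?thesis
      by (simp add: card_image inj_on_subset [OF inj])
  qed
  then show ?thesis
    by (simp add: sum.reindex [OF inj])
qed

text \<open>The coboundary of the restriction on \<open>w\<close> is the coboundary of \<open>u\<close> on the cell \<open>w\<close> regarded in
  the face: inserting the \<open>i\<close>-th coordinate renumbers the free coordinates increasingly.\<close>

lemma L_face_cocycle:
  assumes u: "u \<in> cellular_cocycles n q" and i: "i \<in> {1..q}"
  shows "L_face n q \<epsilon> i u \<in> cellular_cocycles n (q - 1)"
proof -
  let ?g = "\<lambda>k. if k < i then k else Suc k"
  have mono: "strict_mono_on A ?g" for A
    by (auto simp: strict_mono_on_def)
  have insert: "cube_insert i v w (?g k) = w k" for v k and w :: "nat \<Rightarrow> interval_cell"
    by (simp add: cube_insert_def)
  have free: "free_coords (cube_insert i (Fixed \<epsilon>) w) = ?g ` free_coords w" for w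
  proof (intro subset_antisym subsetI)
    fix j assume j: "j \<in> free_coords (cube_insert i (Fixed \<epsilon>) w)"
    then have "j \<noteq> i" by (auto simp: free_coords_def cube_insert_def)
    then have "j = ?g (if j < i then j else j - 1)" by auto
    then obtain k where k: "j = ?g k" by blast
    with j have "w k = Free"
      using insert [of "Fixed \<epsilon>" w k] by (simp add: free_coords_def)
    with k show "j \<in> ?g ` free_coords w"
      unfolding free_coords_def by blast
  next
    fix j assume "j \<in> ?g ` free_coords w"
    then obtain k where "j = ?g k" "w k = Free"
      unfolding free_coords_def by blast
    then show "j \<in> free_coords (cube_insert i (Fixed \<epsilon>) w)"
      by (simp add: free_coords_def insert)
  qed
  have cell: "cube_insert i (Fixed \<epsilon>) w \<in> cube_cells q k" if "w \<in> cube_cells (q - 1) k" for w k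
  proof -
    have "card (free_coords (cube_insert i (Fixed \<epsilon>) w)) = card (free_coords w)"
      unfolding free by (rule card_image) (rule strict_mono_on_imp_inj_on [OF mono])
    moreover have outside: "w j = Fixed False" if "j = 0 \<or> q \<le> j" for j
    proof -
      have "j \<notin> {1..q - 1}" using that i by auto
      then show ?thesis
        using \<open>w \<in> cube_cells (q - 1) k\<close> unfolding cube_cells_def by blast
    qed
    have "cube_insert i (Fixed \<epsilon>) w j = Fixed False" if "j \<notin> {1..q}" for j
      using that i by (auto simp: cube_insert_def outside not_le)
    ultimately show ?thesis
      using that unfolding cube_cells_def by auto
  qed
  have "(\<Sum>j\<in>free_coords w. alt_sign (card {k \<in> free_coords w. k \<le> j})
      (L_face n q \<epsilon> i u (w(j := Fixed False)) - L_face n q \<epsilon> i u (w(j := Fixed True)))) = 0"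
    if w: "w \<in> cube_cells (q - 1) (Suc n)" for w
  proof -
    let ?w = "cube_insert i (Fixed \<epsilon>) w"
    have upd: "cube_insert i (Fixed \<epsilon>) (w(j := a)) = ?w(?g j := a)" for j a
      by (rule ext) (auto simp: cube_insert_def)
    have face_upd: "L_face n q \<epsilon> i u (w(j := Fixed e)) = u (?w(?g j := Fixed e))"
      if "j \<in> free_coords w" for j e
      using cube_cells_upd [OF w that] by (simp only: L_face_def if_True upd)
    have "(\<Sum>j\<in>free_coords w. alt_sign (card {k \<in> free_coords w. k \<le> j})
        (L_face n q \<epsilon> i u (w(j := Fixed False)) - L_face n q \<epsilon> i u (w(j := Fixed True))))
      = (\<Sum>j\<in>free_coords w. alt_sign (card {k \<in> free_coords w. k \<le> j})
        (u (?w(?g j := Fixed False)) - u (?w(?g j := Fixed True))))"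
      by (intro sum.cong refl) (simp only: face_upd)
    also have "\<dots> = (\<Sum>j\<in>free_coords ?w. alt_sign (card {k \<in> free_coords ?w. k \<le> j})
        (u (?w(j := Fixed False)) - u (?w(j := Fixed True))))"
      unfolding free by (rule alternating_sum_reindex [OF mono, symmetric,
        where D = "\<lambda>j. u (?w(j := Fixed False)) - u (?w(j := Fixed True))"])
    also have "\<dots> = 0"
      using u cell [OF w] by (simp add: cellular_cocycles_def)
    finally show ?thesis .
  qed
  then show ?thesis
    by (simp add: cellular_cocycles_def L_face_def)
qed

definition block_coords :: "nat \<Rightarrow> nat \<Rightarrow> (nat \<Rightarrow> interval_cell) \<Rightarrow> nat \<Rightarrow> interval_cell" where
  "block_coords d b w = (\<lambda>i. if i \<in> {1..b} then w (i + d) else Fixed False)"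

text \<open>The pull-back of a cochain of \<open>I\<^sup>b\<close> along the projection of \<open>I\<^sup>q\<close> onto the coordinates
  \<open>d+1, \<dots>, d+b\<close>, where \<open>d+b \<le> q\<close>. It vanishes on the cells which that projection collapses. Both projections of
  \<open>I\<^sup>a \<times> I\<^sup>b\<close> are of this form.\<close>

definition block_pullback :: "nat \<Rightarrow> nat \<Rightarrow> nat \<Rightarrow> nat \<Rightarrow> ((nat \<Rightarrow> interval_cell) \<Rightarrow> 'a::ab_group_add)
    \<Rightarrow> (nat \<Rightarrow> interval_cell) \<Rightarrow> 'a" where
  "block_pullback n q d b v = (\<lambda>w. if w \<in> cube_cells q n \<and> free_coords w \<subseteq> {d+1..d+b}
     then v (block_coords d b w) else 0)"

text \<open>A cell of dimension \<open>n+1\<close> which is not collapsed maps isomorphically to a cell of \<open>I\<^sup>b\<close>. On a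
  cell with a free coordinate \<open>k\<close> outside the block, the two faces in direction \<open>k\<close> have the
  same image, and all other faces still have \<open>k\<close> free and are collapsed.\<close>

lemma block_pullback_cocycle:
  assumes v: "v \<in> cellular_cocycles n b"
  shows "block_pullback n q d b v \<in> cellular_cocycles n q"
proof -
  let ?P = "block_pullback n q d b v" and ?c = "block_coords d b"
  have "(\<Sum>j\<in>free_coords w. alt_sign (card {k \<in> free_coords w. k \<le> j})
      (?P (w(j := Fixed False)) - ?P (w(j := Fixed True)))) = 0"
    if w: "w \<in> cube_cells q (Suc n)" for w
  proof (cases "free_coords w \<subseteq> {d+1..d+b}")
    case True
    have mono: "strict_mono_on A (\<lambda>k. k + d)" for A
      by (auto simp: strict_mono_on_def)
    have free: "free_coords w = (\<lambda>k. k + d) ` free_coords (?c w)"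
    proof (intro subset_antisym subsetI)
      fix j assume j: "j \<in> free_coords w"
      with True have "d + 1 \<le> j \<and> j \<le> d + b" by fastforce
      then have "j - d + d = j" "j - d \<in> {1..b}" by auto
      with j show "j \<in> (\<lambda>k. k + d) ` free_coords (?c w)"
        by (intro image_eqI [of _ _ "j - d"]) (auto simp: free_coords_def block_coords_def)
    qed (auto simp: free_coords_def block_coords_def split: if_splits)
    have "card (free_coords (?c w)) = card (free_coords w)"
      unfolding free by (rule card_image [symmetric]) simp
    then have cell: "?c w \<in> cube_cells b (Suc n)"
      using w by (auto simp: cube_cells_def block_coords_def)
    have upd: "?P (w(k + d := Fixed e)) = v ((?c w)(k := Fixed e))" if k: "k \<in> free_coords (?c w)" for k e
    proof -
      have "k + d \<in> free_coords w" using k free by blast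
      moreover have "?c (w(k + d := Fixed e)) = (?c w)(k := Fixed e)"
        using free_coords_subset [OF cell] k by (auto simp: block_coords_def fun_eq_iff)
      ultimately show ?thesis
        using cube_cells_upd [OF w] True by (auto simp: block_pullback_def free_coords_upd)
    qed
    have "(\<Sum>j\<in>free_coords w. alt_sign (card {k \<in> free_coords w. k \<le> j})
        (?P (w(j := Fixed False)) - ?P (w(j := Fixed True))))
      = (\<Sum>j\<in>free_coords (?c w). alt_sign (card {k \<in> free_coords (?c w). k \<le> j})
        (?P (w(j + d := Fixed False)) - ?P (w(j + d := Fixed True))))"
      unfolding free by (rule alternating_sum_reindex [OF mono])
    also have "\<dots> = (\<Sum>j\<in>free_coords (?c w). alt_sign (card {k \<in> free_coords (?c w). k \<le> j})
        (v ((?c w)(j := Fixed False)) - v ((?c w)(j := Fixed True))))"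
      by (intro sum.cong) (simp_all add: upd)
    also have "\<dots> = 0"
      using v cell by (simp add: cellular_cocycles_def)
    finally show ?thesis .
  next
    case False
    then obtain k where k: "k \<in> free_coords w" "k \<notin> {d+1..d+b}" by blast
    \<comment> \<open>Opposite faces agree; for \<open>j \<noteq> k\<close> both values are zero.\<close>
    have "?P (w(j := Fixed False)) = ?P (w(j := Fixed True))" if j: "j \<in> free_coords w" for j
    proof (cases "j = k")
      case True
      then have "?c (w(j := Fixed False)) = ?c (w(j := Fixed True))"
        using k by (auto simp: block_coords_def fun_eq_iff)
      then show ?thesis
        using cube_cells_upd [OF w j] by (simp add: block_pullback_def free_coords_upd)
    next
      case False
      then show ?thesis
        using k by (auto simp: block_pullback_def free_coords_upd)
    qed
    then show ?thesis by simp
  qed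
  then show ?thesis
    by (simp add: cellular_cocycles_def block_pullback_def)
qed

lemma cellular_cocycles_add:
  assumes "u \<in> cellular_cocycles n q" "v \<in> cellular_cocycles n q"
  shows "(\<lambda>w. u w + v w) \<in> cellular_cocycles n q"
proof -
  have "alt_sign k (a + b - (c + d)) = alt_sign k (a - c) + alt_sign k (b - d)"
    for k and a b c d :: 'a
    by (simp add: alt_sign_def)
  then show ?thesis
    using assms by (simp add: cellular_cocycles_def sum.distrib)
qed

lemma cocycle_prod_eq_pullbacks:
  "cocycle_prod n a b u v
     = (\<lambda>w. block_pullback n (a + b) 0 a u w + block_pullback n (a + b) a b v w)"
proof
  fix w
  show "cocycle_prod n a b u v w = block_pullback n (a + b) 0 a u w + block_pullback n (a + b) a b v w"
  proof (cases "w \<in> cube_cells (a + b) n")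
    case True
    then have "(\<lambda>i. if i \<le> a then w i else Fixed False) = block_coords 0 a w"
      "(\<lambda>i. if i = 0 then Fixed False else w (i + a)) = block_coords a b w"
      by (auto simp: block_coords_def cube_cells_def fun_eq_iff)
    then show ?thesis
      by (simp add: cocycle_prod_def block_pullback_def)
  qed (simp add: cocycle_prod_def block_pullback_def)
qed

lemma cocycle_prod_cocycle:
  assumes "u \<in> cellular_cocycles n a" "v \<in> cellular_cocycles n b"
  shows "cocycle_prod n a b u v \<in> cellular_cocycles n (a + b)"
  unfolding cocycle_prod_eq_pullbacks
  by (intro cellular_cocycles_add block_pullback_cocycle assms)


section \<open>Faces of singular simplices\<close>

lemma singular_simplex_vertex_face:
  assumes \<sigma>: "singular_simplex p B \<sigma>" and vs: "length vs = Suc k" "set vs \<subseteq> {..p}"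
  shows "singular_simplex k B (vertex_face \<sigma> vs)"
proof -
  let ?l = "\<lambda>a i. if i = vs ! a then 1 else 0 :: real"
  have "(\<lambda>i. \<Sum>a\<le>k. ?l a i * x a) \<in> standard_simplex p" if x: "x \<in> standard_simplex k" for x
  proof -
    have nonneg: "0 \<le> (\<Sum>a\<le>k. ?l a i * x a)" for i
      using x by (intro sum_nonneg) (auto simp: standard_simplex_def)
    have "(\<Sum>a\<le>k. ?l a i * x a) \<le> (\<Sum>a\<le>k. x a)" for i
      using x by (intro sum_mono) (auto simp: standard_simplex_def)
    then have le1: "(\<Sum>a\<le>k. ?l a i * x a) \<le> 1" for i
      using x by (simp add: standard_simplex_def)
    have v: "vs ! a \<le> p" if "a \<le> k" for a
      using vs that nth_mem [of a vs] by (metis atMost_iff le_imp_less_Suc subsetD)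
    have zero: "(\<Sum>a\<le>k. ?l a i * x a) = 0" if "p < i" for i
    proof (intro sum.neutral ballI)
      fix a assume "a \<in> {..k}"
      then have "vs ! a \<noteq> i" using v [of a] \<open>p < i\<close> by auto
      then show "?l a i * x a = 0" by simp
    qed
    have "(\<Sum>i\<le>p. \<Sum>a\<le>k. ?l a i * x a) = (\<Sum>a\<le>k. \<Sum>i\<le>p. if i = vs ! a then x a else 0)"
      by (subst sum.swap) (intro sum.cong refl, auto)
    also have "\<dots> = (\<Sum>a\<le>k. x a)"
      using v by (intro sum.cong) auto
    also have "\<dots> = 1"
      using x by (simp add: standard_simplex_def)
    finally show ?thesis
      using nonneg le1 zero by (simp add: standard_simplex_def)
  qed
  then have "simplicial_simplex k (standard_simplex p) (oriented_simplex k ?l)"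
    by (auto simp: simplicial_simplex_oriented_simplex)
  then have "singular_simplex k (subtopology (powertop_real UNIV) (standard_simplex p))
      (oriented_simplex k ?l)"
    by (rule simplicial_imp_singular_simplex)
  moreover have "continuous_map (subtopology (powertop_real UNIV) (standard_simplex p)) B \<sigma>"
    using \<sigma> by (simp add: singular_simplex_def)
  ultimately have "singular_simplex k B (simplex_map k \<sigma> (oriented_simplex k ?l))"
    by (rule singular_simplex_simplex_map)
  with vs show ?thesis
    by (simp add: vertex_face_def)
qed

lemma singular_face_vertex_face:
  assumes "length vs = Suc (Suc k)" "j \<le> Suc k"
  shows "singular_face (Suc k) j (vertex_face \<sigma> vs) = vertex_face \<sigma> (take j vs @ drop (Suc j) vs)"
proof -
  let ?o = "\<lambda>vs k. oriented_simplex k (\<lambda>a i. if i = vs ! a then 1 else 0 :: real)"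
  let ?vs = "take j vs @ drop (Suc j) vs"
  have nth: "?vs ! a = (if a < j then vs ! a else vs ! Suc a)" if "a \<le> k" for a
    using assms that by (auto simp: nth_append min_def)
  have face: "singular_face (Suc k) j (?o vs (Suc k)) = ?o ?vs k"
    using assms(2) by (simp add: singular_face_oriented_simplex oriented_simplex_eq nth)
  have "(?o vs (Suc k) \<circ> simplical_face j) x = ?o ?vs k x" if "x \<in> standard_simplex k" for x
    using that fun_cong [OF face, of x] by (simp add: singular_face_def)
  then have "simplex_map k \<sigma> (?o vs (Suc k) \<circ> simplical_face j) = simplex_map k \<sigma> (?o ?vs k)"
    unfolding simplex_map_def by (intro restrict_ext) (simp only: comp_apply [of \<sigma>])
  moreover have "length ?vs = Suc k" using assms by simp
  ultimately show ?thesis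
    unfolding vertex_face_def using assms by (simp add: singular_face_simplex_map)
qed


section \<open>The cochains \<open>\<kappa>\<^sub>z(\<sigma>)\<close> are cocycles\<close>

lemma free_coords_nonempty:
  assumes "w \<in> cube_cells m n" "n \<ge> 1"
  shows "free_coords w \<noteq> {}"
  using assms by (auto simp: cube_cells_def)

text \<open>The vertices \<open>r\<close> and \<open>q\<close> are characterized without reference to the extremal free coordinates:
  they are zeros of \<open>w\<close> that enclose all free coordinates and have no zero between them. In this form the
  same \<open>r\<close> and \<open>q\<close> can be used for a cell and for its faces.\<close>

lemma kappa_eq:
  assumes w: "w \<in> cube_cells m n" and n: "n \<ge> 1"
    and ends: "w r = Fixed False" "w q = Fixed False" "free_coords w \<subseteq> {r<..<q}"
    and between: "\<And>l. r < l \<Longrightarrow> l < q \<Longrightarrow> w l \<noteq> Fixed False"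
  shows "kappa n m z \<sigma> w = z (vertex_face \<sigma> (r # sorted_list_of_set (free_coords w) @ [q]))"
proof -
  let ?V = "free_coords w"
  have V: "finite ?V" "?V \<noteq> {}"
    using finite_free_coords [OF w] free_coords_nonempty [OF w n] by simp_all
  have lo: "r < Min ?V" "Min ?V < q" and hi: "r < Max ?V" "Max ?V < q"
    using subsetD [OF ends(3) Min_in [OF V]] subsetD [OF ends(3) Max_in [OF V]]
    by simp_all
  have "\<not> (\<exists>l. Min ?V < l \<and> l < Max ?V \<and> w l = Fixed False)"
    using between lo hi by (meson order.strict_trans)
  moreover have "Max {l. l < Min ?V \<and> w l = Fixed False} = r"
  proof (rule Max_eqI)
    show "finite {l. l < Min ?V \<and> w l = Fixed False}"
      by (rule finite_subset [of _ "{..<Min ?V}"]) auto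
    show "y \<le> r" if "y \<in> {l. l < Min ?V \<and> w l = Fixed False}" for y
      using that between [of y] lo(2) by (cases "y \<le> r") simp_all
  qed (use lo ends(1) in simp)
  moreover have "(LEAST l. Max ?V < l \<and> w l = Fixed False) = q"
  proof (rule Least_equality)
    show "q \<le> y" if "Max ?V < y \<and> w y = Fixed False" for y
      using that between [of y] hi(1) by (cases "q \<le> y") simp_all
  qed (use hi ends(2) in simp)
  ultimately show ?thesis
    using w by (auto simp: kappa_def)
qed

lemma kappa_inner_zero:
  assumes "finite (free_coords w)" "i \<in> free_coords w" "j \<in> free_coords w"
    and "i < l" "l < j" "w l = Fixed False"
  shows "kappa n m z \<sigma> w = 0"
proof -
  have "Min (free_coords w) < l \<and> l < Max (free_coords w)"
    using assms Min_le [of "free_coords w" i] Max_ge [of "free_coords w" j] by linarith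
  with \<open>w l = Fixed False\<close> show ?thesis
    unfolding kappa_def by auto
qed

text \<open>The conventions \<open>w 0 = Fixed False\<close> and \<open>w (m + 1) = Fixed False\<close> guarantee that there are zeros
  on either side of the free coordinates; \<open>r\<close> and \<open>q\<close> are those nearest to them.\<close>

lemma cell_cases:
  assumes w: "w \<in> cube_cells m n" and n: "n \<ge> 1"
  obtains (inner_zero) i l j where "i \<in> free_coords w" "j \<in> free_coords w" "i < l" "l < j"
      "w l = Fixed False"
    | (no_inner_zero) r q where "w r = Fixed False" "w q = Fixed False" "free_coords w \<subseteq> {r<..<q}"
      "q \<le> Suc m" "\<And>l. r < l \<Longrightarrow> l < q \<Longrightarrow> w l \<noteq> Fixed False"
proof (cases "\<exists>i\<in>free_coords w. \<exists>j\<in>free_coords w. \<exists>l. i < l \<and> l < j \<and> w l = Fixed False")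
  case True
  then show ?thesis using inner_zero by blast
next
  case False
  let ?V = "free_coords w" and ?R = "{l. l < Min (free_coords w) \<and> w l = Fixed False}"
  let ?q = "LEAST l. Max ?V < l \<and> w l = Fixed False"
  have V: "finite ?V" "?V \<noteq> {}"
    using finite_free_coords [OF w] free_coords_nonempty [OF w n] by simp_all
  have m: "?V \<subseteq> {1..m}" using w by (rule free_coords_subset)
  have R: "finite ?R" "?R \<noteq> {}"
  proof -
    have "0 \<in> ?R"
      using Min_in [OF V] m w by (auto simp: cube_cells_def)
    then show "?R \<noteq> {}" by blast
  qed simp
  have Suc_m: "Max ?V < Suc m \<and> w (Suc m) = Fixed False"
    using Max_in [OF V] m w by (auto simp: cube_cells_def)
  then have q: "Max ?V < ?q" "w ?q = Fixed False" "?q \<le> Suc m"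
    using LeastI [of "\<lambda>l. Max ?V < l \<and> w l = Fixed False" "Suc m"]
      Least_le [of "\<lambda>l. Max ?V < l \<and> w l = Fixed False" "Suc m"] by blast+
  have r: "Max ?R < Min ?V" "w (Max ?R) = Fixed False"
    using Max_in [OF R] by auto
  have "?V \<subseteq> {Max ?R<..<?q}"
  proof
    fix v assume "v \<in> ?V"
    then show "v \<in> {Max ?R<..<?q}"
      using Min_le [OF V(1), of v] Max_ge [OF V(1), of v] q(1) r(1) by simp
  qed
  moreover have "w l \<noteq> Fixed False" if l: "Max ?R < l" "l < ?q" for l
  proof
    assume wl: "w l = Fixed False"
    then have "l \<notin> ?V" by (simp add: free_coords_def)
    then have "l \<noteq> Min ?V" "l \<noteq> Max ?V"
      using Min_in [OF V] Max_in [OF V] by auto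
    moreover have "\<not> l < Min ?V"
    proof
      assume "l < Min ?V"
      with wl have "l \<in> ?R" by simp
      with R(1) have "l \<le> Max ?R" by (rule Max_ge)
      with l(1) show False by linarith
    qed
    moreover have "\<not> Max ?V < l"
      using not_less_Least [OF l(2)] wl by simp
    ultimately have "Min ?V < l" "l < Max ?V" by auto
    with False wl show False
      using Min_in [OF V] Max_in [OF V] by blast
  qed
  ultimately show ?thesis
    using no_inner_zero q r by blast
qed

text \<open>If a zero of \<open>w\<close> still lies between the coordinates that remain free, both values are \<open>0\<close>.
  If not, then \<open>i\<close> is the first or the last free coordinate and that zero
  separates it from the others. So the interval from \<open>r\<close> to \<open>q\<close> does not contain \<open>i\<close>, and the value of \<open>\<kappa>\<^sub>z(\<sigma>)\<close>
  does not depend on \<open>x\<^sub>i\<close>.\<close>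

lemma kappa_upd_inner_zero:
  assumes w: "w \<in> cube_cells m (Suc n)" and n: "n \<ge> 1" and i: "i \<in> free_coords w"
    and zero: "a \<in> free_coords w" "b \<in> free_coords w" "a < l" "l < b" "w l = Fixed False"
  shows "kappa n m z \<sigma> (w(i := Fixed False)) = kappa n m z \<sigma> (w(i := Fixed True))"
proof -
  let ?w = "\<lambda>e. w(i := Fixed e)"
  have cell: "?w e \<in> cube_cells m n" for e
    using w i by (rule cube_cells_upd)
  have free: "free_coords (?w e) = free_coords w - {i}" for e
    by (rule free_coords_upd)
  have fin: "finite (free_coords (?w e))" for e
    using cell by (rule finite_free_coords)
  have "l \<noteq> i" using i zero(5) by (auto simp: free_coords_def)
  from cell [of True] n show ?thesis
  proof (cases rule: cell_cases)
    case (inner_zero i' l' j')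
    then have "l' \<noteq> i" by auto
    with inner_zero have "kappa n m z \<sigma> (?w e) = 0" for e
      by (intro kappa_inner_zero [OF fin, of i' e j' l']) (simp_all add: free)
    then show ?thesis by simp
  next
    case (no_inner_zero r q)
    \<comment> \<open>Otherwise \<open>a\<close>, \<open>b\<close> and the zero \<open>l\<close> between them would lie between \<open>r\<close> and \<open>q\<close>.\<close>
    have "i \<notin> {r<..<q}"
    proof
      assume "i \<in> {r<..<q}"
      moreover have "free_coords w - {i} \<subseteq> {r<..<q}"
        using no_inner_zero(3) by (simp only: free)
      ultimately have "a \<in> {r<..<q}" "b \<in> {r<..<q}"
        using zero(1,2) by blast+
      then have "?w True l \<noteq> Fixed False"
        using no_inner_zero(5) [of l] zero(3,4) by simp
      with zero \<open>l \<noteq> i\<close> show False by simp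
    qed
    then have between: "?w False l' \<noteq> Fixed False" if "r < l'" "l' < q" for l'
      using no_inner_zero(5) [OF that] that by (cases "l' = i") auto
    have "r \<noteq> i" "q \<noteq> i"
      using no_inner_zero(1,2) by auto
    then have ends: "?w False r = Fixed False" "?w False q = Fixed False"
      using no_inner_zero(1,2) by auto
    have "free_coords (?w False) \<subseteq> {r<..<q}"
      using no_inner_zero(3) by (simp only: free)
    then have "kappa n m z \<sigma> (?w False)
        = z (vertex_face \<sigma> (r # sorted_list_of_set (free_coords (?w False)) @ [q]))"
      using cell n ends between by (intro kappa_eq)
    moreover have "kappa n m z \<sigma> (?w True)
        = z (vertex_face \<sigma> (r # sorted_list_of_set (free_coords (?w True)) @ [q]))"
      using cell n no_inner_zero by (intro kappa_eq)
    ultimately show ?thesis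
      by (simp only: free)
  qed
qed

lemma sorted_list_of_set_remove_nth:
  fixes V :: "nat set"
  assumes "finite V" "j < card V"
  shows "sorted_list_of_set (V - {sorted_list_of_set V ! j})
    = take j (sorted_list_of_set V) @ drop (Suc j) (sorted_list_of_set V)"
proof -
  let ?xs = "sorted_list_of_set V"
  have split: "?xs = take j ?xs @ ?xs ! j # drop (Suc j) ?xs"
    using assms by (intro id_take_nth_drop) simp
  have sorted: "sorted_wrt (<) (take j ?xs @ ?xs ! j # drop (Suc j) ?xs)"
    and V: "set (take j ?xs @ ?xs ! j # drop (Suc j) ?xs) = V"
    using assms by (simp_all flip: split)
  have "distinct (take j ?xs @ ?xs ! j # drop (Suc j) ?xs)"
    using assms by (simp flip: split)
  then have "set (take j ?xs @ drop (Suc j) ?xs) = V - {?xs ! j}"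
    using V by auto
  moreover have "sorted_wrt (<) (take j ?xs @ drop (Suc j) ?xs)"
    using sorted by (auto simp: sorted_wrt_append)
  ultimately show ?thesis
    by (metis sorted_list_of_set.idem_if_sorted_distinct strict_sorted_iff)
qed

text \<open>The terms omitting the end vertices \<open>r\<close> and \<open>q\<close> are split off, because in the coboundary of
  \<open>\<kappa>\<^sub>z(\<sigma>)\<close> they come from the faces \<open>x\<^sub>i = 0\<close> and the remaining ones from the faces \<open>x\<^sub>i = 1\<close>. The sign of
  the last term is \<open>(-1)\<^bsup>n+2\<^esup> = (-1)\<^sup>n\<close>.\<close>

lemma coboundary_vertex_face:
  assumes xs: "length xs = Suc n"
  shows "singular_coboundary (Suc n) z (vertex_face \<sigma> (r # xs @ [q]))
    = z (vertex_face \<sigma> (xs @ [q]))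
      + (\<Sum>j\<le>n. alt_sign (Suc j) (z (vertex_face \<sigma> (r # (take j xs @ drop (Suc j) xs) @ [q]))))
      + alt_sign n (z (vertex_face \<sigma> (r # xs)))"
proof -
  let ?L = "r # xs @ [q]"
  let ?z = "\<lambda>k. z (vertex_face \<sigma> (take k ?L @ drop (Suc k) ?L))"
  have "singular_coboundary (Suc n) z (vertex_face \<sigma> ?L) = (\<Sum>k\<le>Suc (Suc n). alt_sign k (?z k))"
    unfolding singular_coboundary_def using xs
    by (intro sum.cong) (simp_all add: singular_face_vertex_face)
  also have "\<dots> = (\<Sum>k\<le>Suc n. alt_sign k (?z k)) + alt_sign n (?z (Suc (Suc n)))"
    by (simp add: alt_sign_def)
  also have "(\<Sum>k\<le>Suc n. alt_sign k (?z k)) = alt_sign 0 (?z 0) + (\<Sum>j\<le>n. alt_sign (Suc j) (?z (Suc j)))"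
    by (rule sum.atMost_Suc_shift)
  also have "(\<Sum>j\<le>n. alt_sign (Suc j) (?z (Suc j)))
      = (\<Sum>j\<le>n. alt_sign (Suc j) (z (vertex_face \<sigma> (r # (take j xs @ drop (Suc j) xs) @ [q]))))"
    using xs by (intro sum.cong) simp_all
  also have "?z (Suc (Suc n)) = z (vertex_face \<sigma> (r # xs))"
    using xs by simp
  finally show ?thesis
    by (simp add: alt_sign_def)
qed

text \<open>On a cell without a zero between its free coordinates, the coboundary of \<open>\<kappa>\<^sub>z(\<sigma>)\<close> is \<open>- \<delta>z\<close> on the
  simplex spanned by \<open>r\<close>, the free coordinates and \<open>q\<close>; on all other cells opposite faces
  cancel.\<close>

lemma kappa_cocycle:
  fixes z :: "((nat \<Rightarrow> real) \<Rightarrow> 'b) \<Rightarrow> 'a::ab_group_add"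
  assumes n: "n \<ge> 1" and z: "z \<in> singular_cocycles (Suc n) B"
    and \<sigma>: "singular_simplex (Suc m) B \<sigma>"
  shows "kappa n m z \<sigma> \<in> cellular_cocycles n m"
proof -
  let ?k = "kappa n m z \<sigma>"
  have "(\<Sum>i\<in>free_coords w. alt_sign (card {k \<in> free_coords w. k \<le> i})
      (?k (w(i := Fixed False)) - ?k (w(i := Fixed True)))) = 0"
    if w: "w \<in> cube_cells m (Suc n)" for w
  proof -
    have "Suc n \<ge> 1" by simp
    with w show ?thesis
    proof (cases rule: cell_cases)
      case (inner_zero a l b)
      then show ?thesis
        by (intro sum.neutral ballI) (simp add: kappa_upd_inner_zero [OF w n _ inner_zero])
    next
      case (no_inner_zero r q)
      define V xs where "V = free_coords w" and "xs = sorted_list_of_set V"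
      have fin: "finite V" and card: "card V = Suc n"
        using finite_free_coords [OF w] w by (simp_all add: V_def cube_cells_def)
      have xs: "length xs = Suc n" "sorted_wrt (<) xs" "set xs = V"
        using fin card by (simp_all add: xs_def)
      have mono: "xs ! i < xs ! j" if "i < j" "j \<le> n" for i j
        using sorted_wrt_nth_less [OF xs(2) that(1)] that(2) xs(1) by simp
      have in_V: "xs ! j \<in> V" if "j \<le> n" for j
        using xs that nth_mem [of j xs] by auto
      have V: "V = (!) xs ` {..n}"
        using xs(1) xs(3) by (auto simp: set_conv_nth less_Suc_eq_le)
      have V_in: "V \<subseteq> {r<..<q}" using no_inner_zero by (simp add: V_def)
      have nth_in: "r < xs ! j" "xs ! j < q" if "j \<le> n" for j
        using in_V [OF that] V_in by auto
      let ?Z = "\<lambda>vs. z (vertex_face \<sigma> vs)"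
      let ?om = "\<lambda>j. take j xs @ drop (Suc j) xs"
      have cell: "w(xs ! j := Fixed e) \<in> cube_cells m n" if "j \<le> n" for j e
        using w in_V [OF that] by (simp add: V_def cube_cells_upd)
      have free: "free_coords (w(xs ! j := Fixed e)) = V - {xs ! j}" for j e
        by (simp add: free_coords_upd V_def)
      have sort: "sorted_list_of_set (V - {xs ! j}) = ?om j" if "j \<le> n" for j
        using that fin card unfolding xs_def by (simp add: sorted_list_of_set_remove_nth)
      have kT: "?k (w(xs ! j := Fixed True)) = ?Z (r # ?om j @ [q])" if j: "j \<le> n" for j
      proof -
        have "?k (w(xs ! j := Fixed True)) = ?Z (r # sorted_list_of_set (V - {xs ! j}) @ [q])"
          unfolding free [of j True, symmetric]
          using no_inner_zero V_in nth_in [OF j]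
          by (intro kappa_eq [OF cell [OF j] n]) (auto simp: free)
        then show ?thesis using sort [OF j] by simp
      qed
      \<comment> \<open>After the first free coordinate has been set to \<open>0\<close>, it is the nearest zero and
        replaces \<open>r\<close>; likewise the last one replaces \<open>q\<close>.\<close>
      have k0: "?k (w(xs ! 0 := Fixed False)) = ?Z (xs @ [q])"
      proof -
        have "xs ! 0 < v" if "v \<in> V - {xs ! 0}" for v
        proof -
          obtain k where k: "k \<le> n" "v = xs ! k"
            using \<open>v \<in> V - {xs ! 0}\<close> V by blast
          with that show ?thesis using mono [of 0 k] by (cases "k = 0") auto
        qed
        then have above: "V - {xs ! 0} \<subseteq> {xs ! 0<..<q}"
          using V_in by (meson DiffD1 greaterThanLessThan_iff subset_iff)
        have "?k (w(xs ! 0 := Fixed False)) = ?Z (xs ! 0 # sorted_list_of_set (V - {xs ! 0}) @ [q])"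
          unfolding free [of 0 False, symmetric]
          using no_inner_zero(2,5) nth_in [of 0] above
          by (intro kappa_eq [OF cell n]) (simp_all add: free)
        moreover have "xs ! 0 # ?om 0 = xs"
          using xs(1) by (cases xs) auto
        ultimately show ?thesis
          using sort [of 0] by (metis append_Cons le0)
      qed
      have kn: "?k (w(xs ! n := Fixed False)) = ?Z (r # xs)"
      proof -
        have "v < xs ! n" if "v \<in> V - {xs ! n}" for v
        proof -
          obtain k where k: "k \<le> n" "v = xs ! k"
            using \<open>v \<in> V - {xs ! n}\<close> V by blast
          with that show ?thesis using mono [of k n] by (cases "k = n") auto
        qed
        then have below: "V - {xs ! n} \<subseteq> {r<..<xs ! n}"
          using V_in by (meson DiffD1 greaterThanLessThan_iff subset_iff)
        have "?k (w(xs ! n := Fixed False)) = ?Z (r # sorted_list_of_set (V - {xs ! n}) @ [xs ! n])"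
          unfolding free [of n False, symmetric]
          using no_inner_zero(1,5) nth_in [of n] below
          by (intro kappa_eq [OF cell n]) (simp_all add: free)
        moreover have "?om n @ [xs ! n] = xs"
          using xs(1) by (simp flip: take_Suc_conv_app_nth)
        ultimately show ?thesis
          using sort [of n] by simp
      qed
      have kF: "?k (w(xs ! j := Fixed False)) = 0" if "0 < j" "j < n" for j
        using that fin in_V [of 0] in_V [of n] mono [of 0 j] mono [of j n]
        by (intro kappa_inner_zero [of _ "xs ! 0" "xs ! n" "xs ! j"]) (auto simp: free)
      have mono_on: "strict_mono_on {..n} ((!) xs)"
        using mono by (auto simp: strict_mono_on_def)
      have card_le: "card {k. k \<le> n \<and> k \<le> j} = Suc j" if "j \<le> n" for j
      proof -
        have "{k. k \<le> n \<and> k \<le> j} = {..j}" using that by auto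
        then show ?thesis by simp
      qed
      have alt_diff: "alt_sign k (a - b) = alt_sign k a - alt_sign k b" for k and a b :: 'a
        by (simp add: alt_sign_def)
      have "(\<Sum>j\<le>n. alt_sign (Suc j) (?k (w(xs ! j := Fixed False))))
          = (\<Sum>j\<in>{0, n}. alt_sign (Suc j) (?k (w(xs ! j := Fixed False))))"
        using kF by (intro sum.mono_neutral_right) auto
      also have "\<dots> = - ?Z (xs @ [q]) - alt_sign n (?Z (r # xs))"
        using n k0 kn by (simp add: alt_sign_def)
      finally have zeros: "(\<Sum>j\<le>n. alt_sign (Suc j) (?k (w(xs ! j := Fixed False))))
          = - ?Z (xs @ [q]) - alt_sign n (?Z (r # xs))" .
      have "(\<Sum>i\<in>V. alt_sign (card {k \<in> V. k \<le> i})
            (?k (w(i := Fixed False)) - ?k (w(i := Fixed True))))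
          = (\<Sum>j\<le>n. alt_sign (card {k \<in> {..n}. k \<le> j})
            (?k (w(xs ! j := Fixed False)) - ?k (w(xs ! j := Fixed True))))"
        unfolding V by (rule alternating_sum_reindex [OF mono_on])
      also have "\<dots> = (\<Sum>j\<le>n. alt_sign (Suc j) (?k (w(xs ! j := Fixed False)))
            - alt_sign (Suc j) (?Z (r # ?om j @ [q])))"
        by (intro sum.cong refl) (simp only: card_le atMost_iff alt_diff kT)
      also have "\<dots> = - singular_coboundary (Suc n) z (vertex_face \<sigma> (r # xs @ [q]))"
        unfolding coboundary_vertex_face [OF xs(1)] sum_subtractf zeros by (simp add: algebra_simps)
      also have "\<dots> = 0"
      proof -
        have "set (r # xs @ [q]) \<subseteq> {..Suc m}"
          using xs(3) V_in no_inner_zero(4) nth_in [of 0] by auto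
        then have "singular_simplex (Suc (Suc n)) B (vertex_face \<sigma> (r # xs @ [q]))"
          using xs(1) by (intro singular_simplex_vertex_face [OF \<sigma>]) auto
        then show ?thesis
          using z by (simp add: singular_cocycles_def)
      qed
      finally show ?thesis by (simp add: V_def)
    qed
  qed
  then show ?thesis
    by (simp add: cellular_cocycles_def kappa_def)
qed


section \<open>The map from the twisted product to the singular cubes of \<open>E\<close>\<close>

text \<open>The faces \<open>d\<^sub>i\<^sup>0\<close> with \<open>i < p\<close> are cubes because \<open>\<kappa>\<^sub>z\<close> and the product \<open>\<circ>\<close> have values in cocycles.\<close>

lemma twisted_product_face_cube:
  assumes n: "n \<ge> 1" and z: "z \<in> singular_cocycles (Suc n) B"
    and c: "c \<in> cubes (twisted_product B n z) (Suc m)" and i: "i \<in> {1..Suc m}"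
  shows "face (twisted_product B n z) (Suc m) \<epsilon> i c \<in> cubes (twisted_product B n z) m"
proof -
  obtain p \<sigma> q \<tau> where c_eq: "c = ((p, \<sigma>), (q, \<tau>))" and pq: "p + q = Suc m"
    and \<sigma>: "singular_simplex p B \<sigma>" and \<tau>: "\<tau> \<in> cellular_cocycles n q"
    using c by (auto simp: twisted_product_def L_complex_def)
  have simplex: "singular_simplex (p - 1) B (singular_face p j \<sigma>)" if "1 \<le> p" "j \<le> p" for j
    using singular_simplex_singular_face [OF \<sigma> that] by simp
  consider "p < i" | "i \<le> p" "\<epsilon> \<or> i = p" | "i < p" "\<not> \<epsilon>"
    by linarith
  then show ?thesis
  proof cases
    case 1
    then have "L_face n q \<epsilon> (i - p) \<tau> \<in> cellular_cocycles n (q - 1)"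
      using \<tau> i pq by (intro L_face_cocycle) auto
    with 1 show ?thesis
      using \<sigma> pq i by (auto simp: c_eq twisted_product_def L_complex_def)
  next
    case 2
    then show ?thesis
      using simplex [of "i - 1"] simplex [of p] \<tau> pq i
      by (auto simp: c_eq twisted_product_def L_complex_def)
  next
    case 3
    have "singular_simplex (i - 1) B (vertex_face \<sigma> [0..<i])"
      using 3 i by (intro singular_simplex_vertex_face [OF \<sigma>]) auto
    moreover have "singular_simplex (Suc (p - i)) B (vertex_face \<sigma> [i - 1..<Suc p])"
      using 3 i by (intro singular_simplex_vertex_face [OF \<sigma>]) (auto simp del: upt_Suc)
    then have "cocycle_prod n (p - i) q (kappa n (p - i) z (vertex_face \<sigma> [i - 1..<Suc p])) \<tau>
        \<in> cellular_cocycles n (p - i + q)"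
      by (intro cocycle_prod_cocycle kappa_cocycle [OF n z] \<tau>)
    ultimately show ?thesis
      using 3 pq i by (auto simp: c_eq twisted_product_def L_complex_def simp del: upt_Suc)
  qed
qed

lemma cube_insert_in_cube:
  assumes "x \<in> standard_cube m" "i \<in> {1..Suc m}"
  shows "cube_insert i (of_bool \<epsilon>) x \<in> standard_cube (Suc m)"
proof -
  have x: "x j = 0" if "j = 0 \<or> m < j" for j
  proof -
    have "j \<notin> {1..m}" using that by auto
    then show ?thesis
      using assms(1) unfolding standard_cube_def by blast
  qed
  have "cube_insert i (of_bool \<epsilon>) x j = 0" if "j \<notin> {1..Suc m}" for j
    using that assms(2) by (auto simp: cube_insert_def x not_le)
  moreover have "0 \<le> cube_insert i (of_bool \<epsilon>) x j \<and> cube_insert i (of_bool \<epsilon>) x j \<le> 1" for j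
    using assms(1) by (simp add: standard_cube_def cube_insert_def)
  ultimately show ?thesis by (simp add: standard_cube_def)
qed

lemma cube_delete_in_cube:
  assumes "x \<in> standard_cube (Suc m)" "i \<in> {1..Suc m}"
  shows "cube_delete i x \<in> standard_cube m"
  using assms by (auto simp: standard_cube_def cube_delete_def)

lemma continuous_map_cubical_cell:
  assumes "c \<in> cubes K m"
  shows "continuous_map (cube_topology m) (cubical_realization K) (cubical_cell K m c)"
proof -
  let ?I = "{(m, c). c \<in> cubes K m}" and ?T = "\<lambda>(m, c). cube_topology m"
  have "continuous_map (?T (m, c)) (sum_topology ?T ?I) (Pair (m, c))"
    using assms by (intro continuous_map_component_injection) auto
  moreover have "continuous_map (sum_topology ?T ?I) (cubical_realization K) (quotient_class (cubical_glue K))"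
    unfolding cubical_realization_def
    by (intro quotient_imp_continuous_map quotient_map_quotient_class)
  ultimately have "continuous_map (?T (m, c)) (cubical_realization K)
      (quotient_class (cubical_glue K) \<circ> Pair (m, c))"
    by (rule continuous_map_compose)
  moreover have "quotient_class (cubical_glue K) \<circ> Pair (m, c) = cubical_cell K m c"
    by (rule ext) (simp add: cubical_cell_def)
  ultimately show ?thesis by simp
qed

text \<open>The identities needed are exactly the two kinds of gluing in the realization, read through \<open>f\<close>.\<close>

lemma comparison_cube_map:
  fixes f :: "((nat \<times> 'c) \<times> (nat \<Rightarrow> real)) set \<Rightarrow> 'y \<times> 'e"
  assumes f: "continuous_map (cubical_realization K) E (snd \<circ> f)"
    and face_cube: "\<And>c m i \<epsilon>. c \<in> cubes K (Suc m) \<Longrightarrow> i \<in> {1..Suc m} \<Longrightarrow> face K (Suc m) \<epsilon> i c \<in> cubes K m"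
    and degen_index: "\<And>c m. c \<in> cubes K m \<Longrightarrow> degen_index K m c \<subseteq> {1..Suc m}"
  shows "cubical_map K (singular_cubical_set E) (comparison_cube K f)"
proof
  fix c m i \<epsilon>
  assume c: "c \<in> cubes K (Suc m)" and i: "i \<in> {1..Suc m}"
  show "face K (Suc m) \<epsilon> i c \<in> cubes K m"
    using c i by (rule face_cube)
  have cell: "cubical_cell K m (face K (Suc m) \<epsilon> i c) x = cubical_cell K (Suc m) c (cube_insert i (of_bool \<epsilon>) x)"
    if "x \<in> standard_cube m" for x
    unfolding cubical_cell_def using c i that by (intro quotient_class_eq cubical_glue.face)
  show "comparison_cube K f m (face K (Suc m) \<epsilon> i c)
      = face (singular_cubical_set E) (Suc m) \<epsilon> i (comparison_cube K f (Suc m) c)"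
    by (rule ext)
       (simp add: comparison_cube_def singular_cubical_set_def restrict_def cell cube_insert_in_cube [OF _ i])
next
  fix c m
  assume c: "c \<in> cubes K m"
  have "continuous_map (cube_topology m) E ((snd \<circ> f) \<circ> cubical_cell K m c)"
    using continuous_map_cubical_cell [OF c] f by (rule continuous_map_compose)
  moreover have "topspace (cube_topology m) = standard_cube m"
    by (simp add: cube_topology_def)
  ultimately have "continuous_map (cube_topology m) E (comparison_cube K f m c)"
    by (elim continuous_map_eq) (simp add: comparison_cube_def)
  then show "comparison_cube K f m c \<in> cubes (singular_cubical_set E) m"
    by (simp add: singular_cubical_set_def comparison_cube_def)
next
  fix c m i
  assume c: "c \<in> cubes K m" and i: "i \<in> degen_index K m c"
  then have i': "i \<in> {1..Suc m}" using degen_index by blast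
  then show "i \<in> degen_index (singular_cubical_set E) m (comparison_cube K f m c)"
    by (simp add: singular_cubical_set_def)
  have cell: "cubical_cell K (Suc m) (degen K m i c) x = cubical_cell K m c (cube_delete i x)"
    if "x \<in> standard_cube (Suc m)" for x
    unfolding cubical_cell_def using c i that by (intro quotient_class_eq cubical_glue.degen)
  show "comparison_cube K f (Suc m) (degen K m i c)
      = degen (singular_cubical_set E) m i (comparison_cube K f m c)"
    by (rule ext)
       (simp add: comparison_cube_def singular_cubical_set_def restrict_def cell cube_delete_in_cube [OF _ i'])
qed

theorem theorem6p1:
  fixes n :: nat and E :: "'e topology" and B :: "'b topology" and p :: "'e \<Rightarrow> 'b"
    and \<theta> :: "'e \<Rightarrow> 'a::ab_group_add \<Rightarrow> ((nat \<Rightarrow> real) \<Rightarrow> 'e) set"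
    and z :: "((nat \<Rightarrow> real) \<Rightarrow> 'b) \<Rightarrow> 'a"
    and \<phi> :: "nat \<Rightarrow> (((nat \<Rightarrow> real) \<Rightarrow> 'e) \<Rightarrow> 'l::comm_ring_1) \<Rightarrow> ('b, 'a) model_cube \<Rightarrow> 'l"
  assumes "n \<ge> 1"
    and "serre_fibration E B p"
    and "\<And>b. b \<in> topspace B \<Longrightarrow> eilenberg_maclane_space TYPE('a) n (fibre E p b)"
    and "fibre_identification n E p \<theta>"
    and "z \<in> singular_cocycles (Suc n) B"
    and "in_obstruction_class n E B p \<theta> z"
    and "canonical_cochain_map n E B p \<theta> z \<phi>"
  shows "cochain_map (singular_cubical_set E) (twisted_product B n z) \<phi>
    \<and> multiplicative (singular_cubical_set E) (twisted_product B n z) \<phi>"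
proof -
  let ?K = "twisted_product B n z"
  obtain s f where "model_comparison n E B p \<theta> z s f"
    and \<phi>: "\<phi> = induced_cochain_map ?K (comparison_cube ?K f)"
    using assms(7) unfolding canonical_cochain_map_def by blast
  then have f: "continuous_map (cubical_realization ?K) (pullback_space E B p) f"
    by (simp add: model_comparison_def Let_def)
  have "continuous_map (pullback_space E B p) E snd"
    unfolding pullback_space_def by (intro continuous_map_from_subtopology continuous_map_snd)
  with f have "continuous_map (cubical_realization ?K) E (snd \<circ> f)"
    by (rule continuous_map_compose)
  then interpret cubical_map ?K "singular_cubical_set E" "comparison_cube ?K f"
    by (rule comparison_cube_map)
       (use twisted_product_face_cube [OF assms(1,5)] in \<open>auto simp: twisted_product_def\<close>)
  show ?thesis
    unfolding \<phi> using cochain_map_induced multiplicative_induced by blast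
qed

end
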